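(* Let $\gamma>0$. The family $(\psi_n)_{n\in\mathbb Z}$ is orthonormal and forms a Hilbertian basis of $L^2(S_\gamma)\cap\mathcal F_\gamma$ (for the $L^2(S_\gamma)$ inner product).
   Context: $\widetilde{\mathcal E}$ is the set of functions $u(z)=e^{-|z|^2/2}f(z)$ with $f$ entire holomorphic on $\mathbb C$ such that $|u(z)|\lesssim\langle z\rangle^M$ for some $M$; $R_\alpha u(z)=e^{(\alpha\overline z-\overline\alpha z)/2}u(z+\alpha)$ for $\alpha\in\mathbb C$; $\mathcal F_\gamma=\{u\in\widetilde{\mathcal E}:R_\gamma u=u\}$; $S_\gamma=\{z\in\mathbb C:-\gamma/2<\mathrm{Re}\,z\le\gamma/2\}$. The family is $$\psi_n(z)=R_{in\pi/\gamma}\psi_0(z)=\Big(\frac2{\pi\gamma^2}\Big)^{1/4}\exp\Big(-\frac{\pi^2n^2}{\gamma^2}+\frac{2in\pi}\gamma z+\frac{z^2}2-\frac{|z|^2}2\Big),\quad n\in\mathbb Z.$$ *)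

theory Defs
  imports "HOL-Complex_Analysis.Complex_Analysis"
begin

definition japanese_bracket :: "complex \<Rightarrow> real" where
  "japanese_bracket z = sqrt (1 + (cmod z)\<^sup>2)"

definition fock_temperate :: "(complex \<Rightarrow> complex) set" where
  "fock_temperate =
     {u. (\<exists>f. f holomorphic_on UNIV \<and>
              (\<forall>z. u z = exp (- of_real ((cmod z)\<^sup>2) / 2) * f z)) \<and>
         (\<exists>M C :: real. \<forall>z. cmod (u z) \<le> C * japanese_bracket z powr M)}"

definition magnetic_translation ::
    "complex \<Rightarrow> (complex \<Rightarrow> complex) \<Rightarrow> complex \<Rightarrow> complex" where
  "magnetic_translation \<alpha> u z = exp ((\<alpha> * cnj z - cnj \<alpha> * z) / 2) * u (z + \<alpha>)"

definition fock_periodic :: "real \<Rightarrow> (complex \<Rightarrow> complex) set" where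
  "fock_periodic \<gamma> = {u \<in> fock_temperate. magnetic_translation (of_real \<gamma>) u = u}"

definition strip :: "real \<Rightarrow> complex set" where
  "strip \<gamma> = {z. - \<gamma> / 2 < Re z \<and> Re z \<le> \<gamma> / 2}"

text \<open>Elements of \<open>L\<^sup>2(S)\<close> are represented by globally defined functions, without quotienting by
  almost-everywhere equality on \<open>S\<close>; \<open>lborel\<close> on the complex plane is the measure \<open>dx dy\<close>.\<close>

definition L2_on :: "complex set \<Rightarrow> (complex \<Rightarrow> complex) set" where
  "L2_on S = {u. set_borel_measurable lborel S u \<and>
                 set_integrable lborel S (\<lambda>z. (cmod (u z))\<^sup>2)}"

definition L2_inner :: "complex set \<Rightarrow> (complex \<Rightarrow> complex) \<Rightarrow> (complex \<Rightarrow> complex) \<Rightarrow> complex" where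
  "L2_inner S u v = (LINT z:S|lborel. u z * cnj (v z))"

definition L2_norm :: "complex set \<Rightarrow> (complex \<Rightarrow> complex) \<Rightarrow> real" where
  "L2_norm S u = sqrt (LINT z:S|lborel. (cmod (u z))\<^sup>2)"

lemma L2_inner_self: "L2_inner S u u = of_real ((L2_norm S u)\<^sup>2)"
proof -
  have "(LINT z:S|lborel. (cmod (u z))\<^sup>2) \<ge> 0"
    unfolding set_lebesgue_integral_def by (intro integral_nonneg_AE) auto
  then show ?thesis
    by (simp add: L2_inner_def L2_norm_def set_integral_complex_of_real
        flip: complex_norm_square of_real_power)
qed

text \<open>A space of functions that is a Hilbert space for the \<open>L\<^sup>2(S)\<close> inner product. Since functions
  are not identified almost everywhere, definiteness of the norm is a genuine requirement.\<close>

definition L2_hilbert_space :: "complex set \<Rightarrow> (complex \<Rightarrow> complex) set \<Rightarrow> bool" where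
  "L2_hilbert_space S V \<longleftrightarrow>
     V \<subseteq> L2_on S \<and>
     (\<lambda>z. 0) \<in> V \<and>
     (\<forall>u\<in>V. \<forall>v\<in>V. (\<lambda>z. u z + v z) \<in> V) \<and>
     (\<forall>c. \<forall>u\<in>V. (\<lambda>z. c * u z) \<in> V) \<and>
     (\<forall>u\<in>V. L2_norm S u = 0 \<longrightarrow> u = (\<lambda>z. 0)) \<and>
     (\<forall>u :: nat \<Rightarrow> complex \<Rightarrow> complex.
        (\<forall>k. u k \<in> V) \<and>
        (\<forall>\<epsilon>>0. \<exists>N. \<forall>j\<ge>N. \<forall>k\<ge>N. L2_norm S (\<lambda>z. u j z - u k z) < \<epsilon>) \<longrightarrow>
        (\<exists>v\<in>V. (\<lambda>k. L2_norm S (\<lambda>z. u k z - v z)) \<longlonglongrightarrow> 0))"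

definition L2_orthonormal :: "complex set \<Rightarrow> ('i \<Rightarrow> complex \<Rightarrow> complex) \<Rightarrow> bool" where
  "L2_orthonormal S e \<longleftrightarrow>
     (\<forall>n. e n \<in> L2_on S) \<and> (\<forall>m n. L2_inner S (e m) (e n) = (if m = n then 1 else 0))"

definition L2_hilbert_basis ::
    "complex set \<Rightarrow> (complex \<Rightarrow> complex) set \<Rightarrow> ('i \<Rightarrow> complex \<Rightarrow> complex) \<Rightarrow> bool" where
  "L2_hilbert_basis S V e \<longleftrightarrow>
     L2_hilbert_space S V \<and>
     (\<forall>n. e n \<in> V) \<and>
     L2_orthonormal S e \<and>
     (\<forall>u\<in>V. \<forall>\<epsilon>>0. \<exists>F c. finite F \<and> L2_norm S (\<lambda>z. u z - (\<Sum>n\<in>F. c n * e n z)) < \<epsilon>)"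

definition psi :: "real \<Rightarrow> int \<Rightarrow> complex \<Rightarrow> complex" where
  "psi \<gamma> n z = of_real ((2 / (pi * \<gamma>\<^sup>2)) powr (1 / 4)) *
     exp (- of_real (pi\<^sup>2 * (of_int n)\<^sup>2 / \<gamma>\<^sup>2) + 2 * \<i> * of_int n * of_real pi / of_real \<gamma> * z
          + z\<^sup>2 / 2 - of_real ((cmod z)\<^sup>2) / 2)"

lemma psi_eq_magnetic_translation:
  "psi \<gamma> n = magnetic_translation (\<i> * of_int n * of_real pi / of_real \<gamma>) (psi \<gamma> 0)"
proof
  fix z
  define a :: real where "a = of_int n * pi / \<gamma>"
  have a: "\<i> * of_int n * of_real pi / of_real \<gamma> = \<i> * complex_of_real a"
    by (simp add: a_def)
  have exponent:
    "- of_real (pi\<^sup>2 * (of_int n)\<^sup>2 / \<gamma>\<^sup>2) + 2 * \<i> * of_int n * of_real pi / of_real \<gamma> * z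
       + z\<^sup>2 / 2 - of_real ((cmod z)\<^sup>2) / 2
     = (\<i> * of_real a * cnj z - cnj (\<i> * of_real a) * z) / 2
       + ((z + \<i> * of_real a)\<^sup>2 / 2 - of_real ((cmod (z + \<i> * of_real a))\<^sup>2) / 2)"
  proof -
    have "- of_real (pi\<^sup>2 * (of_int n)\<^sup>2 / \<gamma>\<^sup>2) = - (complex_of_real a)\<^sup>2"
      by (simp add: a_def power_mult_distrib power_divide mult.commute)
    moreover have "2 * \<i> * of_int n * of_real pi / of_real \<gamma> * z = 2 * \<i> * of_real a * z"
      by (simp add: a_def)
    ultimately show ?thesis
      by (simp only: complex_norm_square)
        (simp add: complex_eq_iff power2_eq_square field_simps)
  qed
  show "psi \<gamma> n z = magnetic_translation (\<i> * of_int n * of_real pi / of_real \<gamma>) (psi \<gamma> 0) z"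
    unfolding psi_def magnetic_translation_def a exponent
    by (simp add: exp_add)
qed

end

theory Submission
  imports Defs "HOL-Probability.Distributions"
begin

text \<open>Write \<open>u z = e\<^bsup>z\<^sup>2/2 - |z|\<^sup>2/2\<^esup> g z\<close>; then \<open>R\<^sub>\<gamma> u = u\<close> says that the entire function \<open>g\<close> has
  period \<open>\<gamma>\<close>, so it descends through \<open>z \<mapsto> e\<^bsup>2\<pi>iz/\<gamma>\<^esup>\<close> to a function on the punctured plane whose Laurent
  series is the Fourier series of \<open>g\<close>. Fubini and a Gaussian integral identify its terms with
  \<open>\<langle>u, \<psi>\<^sub>n\<rangle> \<psi>\<^sub>n z\<close>, so \<open>u\<close> is the pointwise limit of its symmetric partial sums. As
  \<open>\<Sum>\<^sub>n |\<psi>\<^sub>n z|\<close> is bounded in \<open>z\<close>, Bessel gives \<open>|u z| \<le> C \<parallel>u\<parallel>\<close>: Cauchy sequences converge uniformly,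
  hence to a function of the space. Bessel and Fatou turn the pointwise expansion into convergence
  in norm.\<close>

section \<open>Laurent series on the punctured plane\<close>

text \<open>The exponent z^2/2 - |z|^2/2 equals i z Im z. The factor split off from u is therefore
  itself fixed by R_\<gamma>, has no zeros, and has modulus e^(-(Im z)^2), so that across the width
  of the strip only the periodic factor g matters. The strip is unbounded in the direction of Im z.
  What tames that direction is that Laurent coefficients are the same on every circle about 0, that
  is on every horizontal line: the inner integral over x in Fubini is then a constant times an
  explicit Gaussian in y. Completing the square shows |\<psi>_n z| to be a Gaussian in Im z of
  height independent of n, centred at -\<pi> n/\<gamma>; equally spaced centres are what bounds the
  sum of the moduli. Functions are not identified almost everywhere, so definiteness and limits
  concern values at every point, also off the strip. This is why an estimate at each point, and not
  the completeness of L^2, carries the Hilbert space property.\<close>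

definition laurent_coeff :: "(complex \<Rightarrow> complex) \<Rightarrow> int \<Rightarrow> complex" where
  "laurent_coeff h n =
     contour_integral (circlepath 0 1) (\<lambda>w. h w * w powi (- n - 1)) / (2 * of_real pi * \<i>)"

lemma contour_integral_circlepath_powi:
  assumes "r > 0"
  shows "contour_integral (circlepath 0 r) (\<lambda>w. w powi (n - 1)) =
           (if n = 0 then 2 * of_real pi * \<i> else 0)"
proof (cases "n = 0")
  case True
  have "contour_integral (circlepath 0 r) (\<lambda>w. w powi (n - 1)) = contour_integral (circlepath 0 r) (\<lambda>w. 1 / (w - 0))"
    using True by (simp add: power_int_minus field_simps)
  also have "\<dots> = 2 * of_real pi * \<i>"
    using assms by (subst contour_integral_circlepath) auto
  finally show ?thesis using True by simp
next
  case False
  have "((\<lambda>w. w powi (n - 1)) has_contour_integral 0) (circlepath 0 r)"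
  proof (rule Cauchy_theorem_primitive[of "- {0}" "\<lambda>w. w powi n / of_int n"])
    show "((\<lambda>w. w powi n / of_int n) has_field_derivative z powi (n - 1)) (at z within - {0})"
      if "z \<in> - {0}" for z
      using that False by (auto intro!: derivative_eq_intros simp: field_simps)
  qed (use assms in auto)
  then show ?thesis using False by (simp add: contour_integral_unique)
qed

lemma holomorphic_mult_powi:
  assumes "h holomorphic_on - {0}"
  shows "(\<lambda>w. h w * w powi k) holomorphic_on - {0}"
  using assms by (auto intro!: holomorphic_intros)

lemma contour_integrable_mult_powi:
  assumes "h holomorphic_on - {0}" "r > 0"
  shows "(\<lambda>w. h w * w powi k) contour_integrable_on circlepath 0 r"
  using assms(2)
  by (intro contour_integrable_holomorphic_simple[OF holomorphic_mult_powi[OF assms(1)]])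
     auto

text \<open>Two circles about 0 bound an annulus inside the punctured plane, so any radius computes
  the coefficient. This freedom serves twice: the tails at a point need circles on both sides of it,
  and lines of different height correspond to different radii.\<close>

lemma laurent_coeff_eq:
  assumes h: "h holomorphic_on - {0}" and r: "r > 0"
  shows "laurent_coeff h n =
    contour_integral (circlepath 0 r) (\<lambda>w. h w * w powi (- n - 1)) / (2 * of_real pi * \<i>)"
proof -
  have eq: "contour_integral (circlepath 0 b) (\<lambda>w. h w * w powi (- n - 1)) =
        contour_integral (circlepath 0 a) (\<lambda>w. h w * w powi (- n - 1))" if "0 < a" "a \<le> b" for a b
    by (rule contour_integral_circlepath_eq(3)[OF open_UNIV holomorphic_mult_powi[OF h, unfolded Compl_eq_Diff_UNIV] that subset_UNIV])
  have "contour_integral (circlepath 0 1) (\<lambda>w. h w * w powi (- n - 1)) =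
        contour_integral (circlepath 0 r) (\<lambda>w. h w * w powi (- n - 1))"
  proof (cases "r \<le> 1")
    case True
    then show ?thesis by (rule eq[OF r])
  next
    case False
    then show ?thesis by (intro eq[symmetric]) auto
  qed
  then show ?thesis by (simp only: laurent_coeff_def)
qed

text \<open>Cauchy's estimate. The constant depends on \<open>r\<close> but not on \<open>n\<close>,
  so a radius beyond or below a given modulus yields geometric decay of the terms for positive or
  negative indices respectively.\<close>

lemma laurent_coeff_bound:
  assumes h: "h holomorphic_on - {0}" and r: "r > 0"
  obtains M where "\<And>n. cmod (laurent_coeff h n) \<le> M * r powi (- n)"
proof -
  have "continuous_on (sphere 0 r) h"
    using h r by (intro holomorphic_on_imp_continuous_on) (auto elim: holomorphic_on_subset)
  then have "bounded (h ` sphere 0 r)"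
    by (intro compact_imp_bounded compact_continuous_image) auto
  then obtain M where M: "M > 0" "\<And>w. cmod w = r \<Longrightarrow> cmod (h w) \<le> M"
    by (auto simp: bounded_pos)
  have "cmod (laurent_coeff h n) \<le> M * r powi (- n)" for n
  proof -
    have "cmod (contour_integral (circlepath 0 r) (\<lambda>w. h w * w powi (- n - 1))) \<le>
            (M * r powi (- n - 1)) * (2 * pi * r)"
      by (rule has_contour_integral_bound_circlepath
            [OF has_contour_integral_integral[OF contour_integrable_mult_powi[OF h r]]])
         (use M r in \<open>auto simp: norm_mult norm_power_int intro!: mult_right_mono\<close>)
    also have "r powi (- n - 1) = r powi (- n) / r"
      using r by (subst power_int_diff) auto
    finally show ?thesis
      using r by (subst laurent_coeff_eq[OF h r]) (simp add: norm_divide norm_mult field_simps)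
  qed
  then show ?thesis using that by blast
qed

text \<open>A factor \<open>w\<close> turns the coefficient integral of index \<open>n\<close> into
  that of index \<open>n - 1\<close>, and a constant contributes to index 0 alone.\<close>

lemma laurent_coeff_quotient:
  assumes h: "h holomorphic_on - {0}" and G: "G holomorphic_on - {0}"
    and eq: "\<And>w. w \<noteq> 0 \<Longrightarrow> h w = c + (w - \<zeta>) * G w"
  shows "laurent_coeff h n =
           (if n = 0 then c else 0) + laurent_coeff G (n - 1) - \<zeta> * laurent_coeff G n"
proof -
  let ?\<gamma> = "circlepath 0 1" and ?I = "contour_integral (circlepath 0 1)"
  have c: "((\<lambda>w. w powi (- n - 1)) has_contour_integral (if n = 0 then 2 * of_real pi * \<i> else 0)) ?\<gamma>"
    using has_contour_integral_integral[OF contour_integrable_mult_powi[of "\<lambda>_. 1" 1 "- n - 1"]]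
      contour_integral_circlepath_powi[of 1 "- n"] by simp
  have G_int: "((\<lambda>w. G w * w powi k) has_contour_integral ?I (\<lambda>w. G w * w powi k)) ?\<gamma>" for k
    by (intro has_contour_integral_integral contour_integrable_mult_powi G) simp
  have "((\<lambda>w. h w * w powi (- n - 1)) has_contour_integral
          c * (if n = 0 then 2 * of_real pi * \<i> else 0) + ?I (\<lambda>w. G w * w powi (- n))
            - \<zeta> * ?I (\<lambda>w. G w * w powi (- n - 1))) ?\<gamma>"
  proof (rule has_contour_integral_eq)
    show "((\<lambda>w. c * w powi (- n - 1) + G w * w powi (- n) - \<zeta> * (G w * w powi (- n - 1)))
        has_contour_integral c * (if n = 0 then 2 * of_real pi * \<i> else 0)
          + ?I (\<lambda>w. G w * w powi (- n)) - \<zeta> * ?I (\<lambda>w. G w * w powi (- n - 1))) ?\<gamma>"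
      by (intro has_contour_integral_diff has_contour_integral_add has_contour_integral_lmul c G_int)
    fix w assume "w \<in> path_image ?\<gamma>"
    then have w: "w \<noteq> 0" by auto
    have "w powi (- n) = w * w powi (- n - 1)"
      using w by (simp add: power_int_diff)
    then show "c * w powi (- n - 1) + G w * w powi (- n) - \<zeta> * (G w * w powi (- n - 1)) =
        h w * w powi (- n - 1)"
      unfolding eq[OF w] by (simp add: algebra_simps)
  qed
  then have "?I (\<lambda>w. h w * w powi (- n - 1)) =
      c * (if n = 0 then 2 * of_real pi * \<i> else 0) + ?I (\<lambda>w. G w * w powi (- n))
        - \<zeta> * ?I (\<lambda>w. G w * w powi (- n - 1))"
    by (rule contour_integral_unique)
  then show ?thesis
    by (simp add: laurent_coeff_def diff_divide_distrib add_divide_distrib)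
qed

lemma sum_telescope_int:
  fixes f :: "int \<Rightarrow> 'a::ab_group_add"
  shows "(\<Sum>n\<in>{- int N..int N}. f (n - 1) - f n) = f (- int N - 1) - f (int N)"
proof (induction N)
  case (Suc N)
  have "{- int (Suc N)..int (Suc N)} =
      insert (- int N - 1) (insert (int N + 1) {- int N..int N})"
    by auto
  then show ?case using Suc by (simp add: algebra_simps)
qed simp

text \<open>If \<open>G w = (h w - h \<zeta>) / (w - \<zeta>)\<close>, then \<open>a\<^sub>n(h) = h \<zeta> \<delta>\<^sub>n\<^sub>0 + a\<^sub>n\<^sub>-\<^sub>1(G) - \<zeta> a\<^sub>n(G)\<close>, so the symmetric
  partial sums telescope to \<open>h \<zeta>\<close> plus two terms that vanish by Cauchy's estimates for \<open>G\<close>.\<close>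

lemma laurent_expansion:
  assumes h: "h holomorphic_on - {0}" and \<zeta>: "\<zeta> \<noteq> 0"
  shows "(\<lambda>N. \<Sum>n\<in>{- int N..int N}. laurent_coeff h n * \<zeta> powi n) \<longlonglongrightarrow> h \<zeta>"
proof -
  define G where "G w = (if w = \<zeta> then deriv h \<zeta> else (h w - h \<zeta>) / (w - \<zeta>))" for w
  have G: "G holomorphic_on - {0}"
    unfolding G_def using \<zeta> by (intro pole_lemma h) (simp_all add: interior_open open_Compl)
  have rec: "laurent_coeff h n =
      (if n = 0 then h \<zeta> else 0) + laurent_coeff G (n - 1) - \<zeta> * laurent_coeff G n" for n
    by (rule laurent_coeff_quotient[OF h G]) (auto simp: G_def)
  \<comment> \<open>The exponent is \<open>n + 1\<close> so that both correction terms, multiplied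
    by \<open>\<zeta> powi n\<close>, are values of one sequence: the term with index
    \<open>n - 1\<close> becomes \<open>T (n - 1)\<close>, the one with the extra
    \<open>\<zeta>\<close> becomes \<open>T n\<close>.\<close>
  define T where "T n = laurent_coeff G n * \<zeta> powi (n + 1)" for n
  have term_eq: "laurent_coeff h n * \<zeta> powi n = (if n = 0 then h \<zeta> else 0) + (T (n - 1) - T n)" for n
    using \<zeta> by (simp add: rec T_def power_int_add algebra_simps)
  have sum_eq: "(\<Sum>n\<in>{- int N..int N}. laurent_coeff h n * \<zeta> powi n) =
      h \<zeta> + (T (- int N - 1) - T (int N))" for N
    unfolding term_eq sum.distrib sum_telescope_int by (simp add: sum.delta)
  define s where "s = cmod \<zeta>"
  have s: "s > 0" using \<zeta> by (simp add: s_def)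
  have upper: "(\<lambda>N. T (int N)) \<longlonglongrightarrow> 0"
  proof -
    \<comment> \<open>A circle of twice the modulus of \<open>\<zeta>\<close> gives the ratio 1/2
      for indices tending to infinity.\<close>
    obtain M where M: "\<And>n. cmod (laurent_coeff G n) \<le> M * (2 * s) powi (- n)"
      using laurent_coeff_bound[OF G, of "2 * s"] s by auto
    have "cmod (T (int N)) \<le> M * s * (1 / 2) ^ N" for N
    proof -
      have "cmod (T (int N)) \<le> M * (2 * s) powi (- int N) * s powi (int N + 1)"
        unfolding T_def norm_mult norm_power_int s_def[symmetric]
        using s by (intro mult_right_mono M) auto
      also have "(2 * s) powi (- int N) = inverse (s ^ N) * (1 / 2) ^ N"
        by (simp add: power_int_minus power_mult_distrib power_one_over field_simps)
      also have "s powi (int N + 1) = s ^ N * s"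
        using s by (simp add: power_int_add)
      also have "M * (inverse (s ^ N) * (1 / 2) ^ N) * (s ^ N * s) = M * s * (1 / 2) ^ N"
        using s by simp
      finally show ?thesis .
    qed
    moreover have "(\<lambda>N. M * s * (1 / 2) ^ N) \<longlonglongrightarrow> 0"
      by (intro tendsto_mult_right_zero LIMSEQ_power_zero) auto
    ultimately show ?thesis by (rule Lim_null_comparison[OF always_eventually[OF allI]])
  qed
  have lower: "(\<lambda>N. T (- int N - 1)) \<longlonglongrightarrow> 0"
  proof -
    \<comment> \<open>For indices tending to minus infinity the circle must lie inside; half the
      modulus gives the same ratio.\<close>
    obtain M where M: "\<And>n. cmod (laurent_coeff G n) \<le> M * (s / 2) powi (- n)"
      using laurent_coeff_bound[OF G, of "s / 2"] s by auto
    have "cmod (T (- int N - 1)) \<le> M * s / 2 * (1 / 2) ^ N" for N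
    proof -
      have "cmod (T (- int N - 1)) \<le> M * (s / 2) powi (- (- int N - 1)) * s powi (- int N - 1 + 1)"
        unfolding T_def norm_mult norm_power_int s_def[symmetric]
        using s by (intro mult_right_mono M) auto
      also have "(s / 2) powi (- (- int N - 1)) = s ^ (N + 1) * (1 / 2) ^ (N + 1)"
        using s by (simp add: power_int_def nat_add_distrib power_divide)
      also have "s powi (- int N - 1 + 1) = inverse (s ^ N)"
        using s by (simp add: power_int_minus)
      also have "M * (s ^ (N + 1) * (1 / 2) ^ (N + 1)) * inverse (s ^ N) = M * s / 2 * (1 / 2) ^ N"
        using s by simp
      finally show ?thesis .
    qed
    moreover have "(\<lambda>N. M * s / 2 * (1 / 2) ^ N) \<longlonglongrightarrow> 0"
      by (intro tendsto_mult_right_zero LIMSEQ_power_zero) auto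
    ultimately show ?thesis by (rule Lim_null_comparison[OF always_eventually[OF allI]])
  qed
  have "(\<lambda>N. h \<zeta> + (T (- int N - 1) - T (int N))) \<longlonglongrightarrow> h \<zeta> + (0 - 0)"
    by (intro tendsto_intros lower upper)
  then show ?thesis by (simp add: sum_eq)
qed

section \<open>Fourier series of periodic entire functions\<close>

definition fourier_mode :: "real \<Rightarrow> int \<Rightarrow> complex \<Rightarrow> complex" where
  "fourier_mode \<gamma> n z = exp (2 * of_real pi * \<i> * of_int n * z / of_real \<gamma>)"

lemma fourier_mode_nonzero [simp]: "fourier_mode \<gamma> n z \<noteq> 0"
  by (simp add: fourier_mode_def)

lemma fourier_mode_powi: "fourier_mode \<gamma> 1 z powi n = fourier_mode \<gamma> n z"
  by (simp add: fourier_mode_def exp_power_int algebra_simps)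

lemma fourier_mode_minus: "fourier_mode \<gamma> (- n) z = inverse (fourier_mode \<gamma> n z)"
  by (simp add: fourier_mode_def exp_minus)

lemma fourier_mode_add: "fourier_mode \<gamma> n (z + w) = fourier_mode \<gamma> n z * fourier_mode \<gamma> n w"
  by (simp add: fourier_mode_def add_divide_distrib distrib_left exp_add)

lemma fourier_mode_period:
  assumes "\<gamma> \<noteq> 0"
  shows "fourier_mode \<gamma> n (z + of_real \<gamma>) = fourier_mode \<gamma> n z"
  using assms exp_integer_2pi[of "of_int n"] by (simp add: fourier_mode_def add_divide_distrib distrib_left exp_add mult_ac)

lemma periodic_of_int:
  fixes k :: "complex \<Rightarrow> 'a"
  assumes per: "\<And>z. k (z + p) = k z"
  shows "k (z + of_int m * p) = k z"
proof -
  have nat: "k (z + of_nat n * p) = k z" for n z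
  proof (induction n)
    case (Suc n)
    have "k (z + of_nat (Suc n) * p) = k ((z + of_nat n * p) + p)"
      by (simp add: algebra_simps)
    then show ?case using Suc per by simp
  qed simp
  show ?thesis
  proof (cases "m \<ge> 0")
    case True
    then show ?thesis using nat[of z "nat m"] by simp
  next
    case False
    then show ?thesis using nat[of "z + of_int m * p" "nat (- m)"] by simp
  qed
qed

text \<open>A branch of the logarithm inverts the mode, and periodicity makes \<open>k\<close> of
  the result independent of the branch. Holomorphy away from the cut of one branch, and away from
  that of another, covers the punctured plane.\<close>

lemma periodic_entire_descends:
  assumes \<gamma>: "\<gamma> \<noteq> 0" and k: "k holomorphic_on UNIV" and per: "\<And>z. k (z + of_real \<gamma>) = k z"
  obtains h where "h holomorphic_on - {0}" "\<And>z. h (fourier_mode \<gamma> 1 z) = k z"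
proof -
  define L where "L w = Ln w * of_real \<gamma> / (2 * of_real pi * \<i>)" for w
  define h where "h w = k (L w)" for w
  have eq: "k z = k z'" if "fourier_mode \<gamma> 1 z = fourier_mode \<gamma> 1 z'" for z z'
  proof -
    have "exp (2 * of_real pi * \<i> * z / of_real \<gamma>) = exp (2 * of_real pi * \<i> * z' / of_real \<gamma>)"
      using that by (simp add: fourier_mode_def)
    then obtain n :: int where n: "2 * of_real pi * \<i> * z / of_real \<gamma> =
        2 * of_real pi * \<i> * z' / of_real \<gamma> + of_real (of_int (2 * n) * pi) * \<i>"
      unfolding exp_eq by blast
    then have "2 * of_real pi * \<i> * z = 2 * of_real pi * \<i> * (z' + of_int n * of_real \<gamma>)"
      using \<gamma> by (simp add: field_simps)
    then have "z = z' + of_int n * of_real \<gamma>" by simp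
    then show ?thesis using periodic_of_int[of k "of_real \<gamma>", OF per] by simp
  qed
  have mode_L: "fourier_mode \<gamma> 1 (L w) = w" if "w \<noteq> 0" for w
    using that \<gamma> by (simp add: fourier_mode_def L_def)
  have h_mode: "h (fourier_mode \<gamma> 1 z) = k z" for z
    unfolding h_def by (intro eq mode_L) simp
  have L_hol: "L holomorphic_on - \<real>\<^sub>\<le>\<^sub>0"
    unfolding L_def by (auto intro!: holomorphic_intros)
  have "h holomorphic_on - \<real>\<^sub>\<le>\<^sub>0"
    unfolding h_def using holomorphic_on_compose_gen[OF L_hol k] by (simp add: o_def)
  moreover have "h holomorphic_on - \<real>\<^sub>\<ge>\<^sub>0"
  proof (rule holomorphic_transform)
    \<comment> \<open>\<open>Ln (- w)\<close> moves the cut to the nonnegative reals; the sign is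
      repaired by half a period, where the mode takes the value -1.\<close>
    have "(\<lambda>w. L (- w) + of_real \<gamma> / 2) holomorphic_on - \<real>\<^sub>\<ge>\<^sub>0"
      unfolding L_def by (auto intro!: holomorphic_intros simp: complex_nonneg_Reals_iff complex_nonpos_Reals_iff)
    from holomorphic_on_compose_gen[OF this k]
    show "(\<lambda>w. k (L (- w) + of_real \<gamma> / 2)) holomorphic_on - \<real>\<^sub>\<ge>\<^sub>0" by (simp add: o_def)
    fix w :: complex assume "w \<in> - \<real>\<^sub>\<ge>\<^sub>0"
    then have w: "w \<noteq> 0" by auto
    have "fourier_mode \<gamma> 1 (of_real \<gamma> / 2) = - 1"
      using \<gamma> by (simp add: fourier_mode_def)
    then have "fourier_mode \<gamma> 1 (L (- w) + of_real \<gamma> / 2) = w"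
      using w by (simp add: fourier_mode_add mode_L)
    then show "k (L (- w) + of_real \<gamma> / 2) = h w"
      using h_mode by metis
  qed
  ultimately have "h holomorphic_on (- \<real>\<^sub>\<le>\<^sub>0 \<union> - \<real>\<^sub>\<ge>\<^sub>0)"
    by (intro holomorphic_on_Un) (auto simp: open_Compl)
  also have "- \<real>\<^sub>\<le>\<^sub>0 \<union> - \<real>\<^sub>\<ge>\<^sub>0 = - {0 :: complex}"
    by (auto simp: complex_nonneg_Reals_iff complex_nonpos_Reals_iff complex_eq_iff)
  finally show ?thesis using that h_mode by blast
qed

text \<open>The mode wraps a segment of length \<open>\<gamma>\<close> at height \<open>y\<close>
  once around the circle of radius e^(-2 \<pi> y/\<gamma>); as every radius gives the same
  coefficient, the value does not depend on \<open>y\<close>. The added \<open>\<gamma> / 2\<close>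
  aligns the centred interval with the parameter of the circle, which starts at angle 0.\<close>

lemma laurent_coeff_has_integral:
  assumes h: "h holomorphic_on - {0}" and \<gamma>: "\<gamma> > 0"
  shows "((\<lambda>x. h (fourier_mode \<gamma> 1 (Complex x y + of_real \<gamma> / 2)) *
               fourier_mode \<gamma> (- n) (Complex x y + of_real \<gamma> / 2))
           has_integral of_real \<gamma> * laurent_coeff h n) {- \<gamma> / 2..\<gamma> / 2}"
proof -
  define r where "r = exp (- 2 * pi * y / \<gamma>)"
  have r: "r > 0" by (simp add: r_def)
  define W where "W t = fourier_mode \<gamma> 1 (Complex (\<gamma> * t) y)" for t
  have W: "circlepath 0 r t = W t" for t
    using \<gamma> by (simp add: circlepath W_def fourier_mode_def r_def exp_of_real[symmetric] Complex_eq
        exp_add[symmetric] field_simps)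
  have deriv: "vector_derivative (circlepath 0 r) (at t within {0..1}) = 2 * of_real pi * \<i> * W t"
    if "t \<in> {0..1}" for t
    using that vector_derivative_circlepath01[of t 0 r] W[of t] by (simp add: circlepath mult_ac)
  have "((\<lambda>w. h w * w powi (- n - 1)) has_contour_integral 2 * of_real pi * \<i> * laurent_coeff h n)
          (circlepath 0 r)"
    using has_contour_integral_integral[OF contour_integrable_mult_powi[OF h r]]
    by (simp add: laurent_coeff_eq[OF h r])
  then have "((\<lambda>t. h (W t) * W t powi (- n - 1) * (2 * of_real pi * \<i> * W t))
      has_integral 2 * of_real pi * \<i> * laurent_coeff h n) {0..1}"
    unfolding has_contour_integral_def
    by (rule has_integral_eq[rotated]) (simp add: deriv W)
  moreover define K where "K = 2 * of_real pi * \<i>"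
  ultimately have "((\<lambda>t. h (W t) * W t powi (- n - 1) * (K * W t) / K)
      has_integral K * laurent_coeff h n / K) {0..1}"
    by (intro has_integral_divide) simp
  moreover have "K \<noteq> 0" by (simp add: K_def)
  ultimately have "((\<lambda>t. h (W t) * W t powi (- n)) has_integral laurent_coeff h n) {0..1}"
    by (simp add: W_def power_int_diff)
  then have "((\<lambda>t. h (W t) * W t powi (- n)) has_integral laurent_coeff h n) (cbox 0 1)"
    by simp
  \<comment> \<open>Substitution t = x/\<gamma> + 1/2, which carries the centred interval to [0, 1]
    and produces the factor \<open>\<gamma>\<close>.\<close>
  from has_integral_affinity'[OF this, of "1 / \<gamma>" "1 / 2"] \<gamma>
  have "((\<lambda>x. h (W (x / \<gamma> + 1 / 2)) * W (x / \<gamma> + 1 / 2) powi (- n))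
      has_integral of_real \<gamma> * laurent_coeff h n) {- \<gamma> / 2..\<gamma> / 2}"
    by (simp add: scaleR_conv_of_real field_simps)
  moreover have "W (x / \<gamma> + 1 / 2) = fourier_mode \<gamma> 1 (Complex x y + of_real \<gamma> / 2)" for x
    using \<gamma> unfolding W_def by (intro arg_cong[of _ _ "fourier_mode \<gamma> 1"]) (simp add: complex_eq_iff field_simps)
  ultimately show ?thesis
    by (simp add: fourier_mode_powi)
qed

lemma periodic_entire_fourier:
  assumes \<gamma>: "\<gamma> > 0" and g: "g holomorphic_on UNIV" and per: "\<And>z. g (z + of_real \<gamma>) = g z"
  obtains a where "\<And>z. (\<lambda>N. \<Sum>n\<in>{- int N..int N}. a n * fourier_mode \<gamma> n z) \<longlonglongrightarrow> g z"
    and "\<And>n y. ((\<lambda>x. g (Complex x y) * fourier_mode \<gamma> (- n) (Complex x y))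
           has_integral of_real \<gamma> * a n) {- \<gamma> / 2..\<gamma> / 2}"
proof -
  \<comment> \<open>Shifting \<open>g\<close> by half a period beforehand cancels the
    \<open>\<gamma> / 2\<close> left by the parametrization of the circle; the coefficients absorb
    \<open>fourier_mode \<gamma> n c\<close>, which is (-1)^n.\<close>
  define c :: complex where "c = of_real \<gamma> / 2"
  have hol: "(\<lambda>z. g (z - c)) holomorphic_on UNIV"
    using holomorphic_on_compose_gen[OF holomorphic_on_diff[OF holomorphic_on_ident holomorphic_on_const] g]
    by (simp add: o_def)
  have per': "g (z + of_real \<gamma> - c) = g (z - c)" for z
    using per[of "z - c"] by (simp add: algebra_simps)
  obtain h where h: "h holomorphic_on - {0}" and h_mode: "\<And>z. h (fourier_mode \<gamma> 1 z) = g (z - c)"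
    using periodic_entire_descends[OF _ hol per'] \<gamma> by auto
  define a where "a n = laurent_coeff h n * fourier_mode \<gamma> n c" for n
  show ?thesis
  proof (rule that[of a])
    show "(\<lambda>N. \<Sum>n\<in>{- int N..int N}. a n * fourier_mode \<gamma> n z) \<longlonglongrightarrow> g z" for z
      using laurent_expansion[OF h, of "fourier_mode \<gamma> 1 (z + c)", unfolded h_mode fourier_mode_powi]
      by (simp add: fourier_mode_add a_def mult_ac)
    fix n y
    have "of_real \<gamma> * laurent_coeff h n / fourier_mode \<gamma> (- n) c = of_real \<gamma> * a n"
      by (simp add: a_def fourier_mode_minus divide_inverse)
    moreover have "((\<lambda>x. g (Complex x y) * fourier_mode \<gamma> (- n) (Complex x y)) has_integral
        of_real \<gamma> * laurent_coeff h n / fourier_mode \<gamma> (- n) c) {- \<gamma> / 2..\<gamma> / 2}"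
      using has_integral_divide[OF laurent_coeff_has_integral[OF h \<gamma>, of y n], of "fourier_mode \<gamma> (- n) c"]
      unfolding c_def[symmetric] h_mode by (simp add: fourier_mode_add)
    ultimately show "((\<lambda>x. g (Complex x y) * fourier_mode \<gamma> (- n) (Complex x y))
           has_integral of_real \<gamma> * a n) {- \<gamma> / 2..\<gamma> / 2}"
      by (simp only:)
  qed
qed

section \<open>Lebesgue measure on the strip\<close>

lemma measurable_Complex_pair [measurable]:
  "(\<lambda>(y, x). Complex x y) \<in> lborel \<Otimes>\<^sub>M lborel \<rightarrow>\<^sub>M borel"
  unfolding lborel_prod case_prod_beta Complex_eq
  by (auto intro!: borel_measurable_continuous_onI continuous_intros)

text \<open>Agreement on boxes determines Lebesgue measure. The pair is ordered as
  \<open>(y, x)\<close> so that Fubini integrates over \<open>x\<close> on the inside, where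
  periodicity acts.\<close>

lemma lborel_complex_eq_distr:
  "(lborel :: complex measure) = distr (lborel \<Otimes>\<^sub>M lborel) borel (\<lambda>(y, x). Complex x y)"
proof (rule lborel_eqI)
  fix l u :: complex
  assume lu: "\<And>b. b \<in> Basis \<Longrightarrow> l \<bullet> b \<le> u \<bullet> b"
  have le: "Re l \<le> Re u" "Im l \<le> Im u"
    using lu[of 1] lu[of \<i>] by (auto simp: Basis_complex_def inner_complex_def)
  have "(\<lambda>(y, x). Complex x y) -` box l u \<inter> space (lborel \<Otimes>\<^sub>M lborel) =
      {Im l<..<Im u} \<times> {Re l<..<Re u}"
    by (auto simp: in_box_complex_iff space_pair_measure)
  then have "emeasure (distr (lborel \<Otimes>\<^sub>M lborel) borel (\<lambda>(y, x). Complex x y)) (box l u) =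
      emeasure (lborel \<Otimes>\<^sub>M lborel) ({Im l<..<Im u} \<times> {Re l<..<Re u})"
    by (simp add: emeasure_distr)
  also have "\<dots> = ennreal (Im u - Im l) * ennreal (Re u - Re l)"
    using le by (subst lborel.emeasure_pair_measure_Times) auto
  also have "\<dots> = ennreal (\<Prod>b\<in>Basis. (u - l) \<bullet> b)"
    using le by (simp add: Basis_complex_def inner_complex_def ennreal_mult mult.commute)
  finally show "emeasure (distr (lborel \<Otimes>\<^sub>M lborel) borel (\<lambda>(y, x). Complex x y)) (box l u) =
      ennreal (\<Prod>b\<in>Basis. (u - l) \<bullet> b)" .
qed simp

lemma sets_strip [measurable]: "strip \<gamma> \<in> sets borel"
  unfolding strip_def by measurable

lemma indicator_strip:
  "(indicator (strip \<gamma>) (Complex x y) :: real) = indicator {- \<gamma> / 2<..\<gamma> / 2} x"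
  by (simp add: indicator_def strip_def)

lemma set_integral_strip:
  fixes f :: "complex \<Rightarrow> 'a::{banach, second_countable_topology}"
  assumes "set_integrable lborel (strip \<gamma>) f"
  shows "(LINT z:strip \<gamma>|lborel. f z) = (LINT y|lborel. (LINT x:{- \<gamma> / 2<..\<gamma> / 2}|lborel. f (Complex x y)))"
proof -
  let ?F = "\<lambda>z. indicator (strip \<gamma>) z *\<^sub>R f z"
  have F: "integrable lborel ?F"
    using assms by (simp add: set_integrable_def)
  then have [measurable]: "?F \<in> borel_measurable borel"
    by (auto dest: borel_measurable_integrable)
  have "integrable (lborel \<Otimes>\<^sub>M lborel) (\<lambda>p. ?F (case p of (y, x) \<Rightarrow> Complex x y))"
    using F by (subst (asm) lborel_complex_eq_distr) (simp add: integrable_distr_eq)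
  from lborel_pair.integral_fst'[OF this]
  have "(LINT y|lborel. (LINT x|lborel. ?F (Complex x y))) =
      integral\<^sup>L (lborel \<Otimes>\<^sub>M lborel) (\<lambda>p. ?F (case p of (y, x) \<Rightarrow> Complex x y))"
    by simp
  also have "\<dots> = integral\<^sup>L lborel ?F"
    by (subst lborel_complex_eq_distr) (simp add: integral_distr)
  finally show ?thesis
    by (simp add: set_lebesgue_integral_def indicator_strip)
qed

text \<open>The moduli of the weighted modes depend on Im z alone; since the strip has finite width,
  integrability of the profile in y suffices.\<close>

lemma set_integrable_strip_Im:
  fixes f :: "real \<Rightarrow> real"
  assumes f: "integrable lborel f" and "\<gamma> > 0"
  shows "set_integrable lborel (strip \<gamma>) (\<lambda>z. f (Im z))"
proof -
  let ?F = "\<lambda>z. indicator (strip \<gamma>) z *\<^sub>R f (Im z)"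
  have [measurable]: "f \<in> borel_measurable borel"
    using f by (auto dest: borel_measurable_integrable)
  have F[measurable]: "?F \<in> borel_measurable borel" by measurable
  have "integrable (lborel \<Otimes>\<^sub>M lborel) (\<lambda>p. ?F (case p of (y, x) \<Rightarrow> Complex x y))"
  proof (rule lborel_pair.Fubini_integrable)
    have norm_eq: "norm (?F (case (y, x) of (y, x) \<Rightarrow> Complex x y)) =
        indicator {- \<gamma> / 2<..\<gamma> / 2} x * \<bar>f y\<bar>" for x y
      by (simp add: indicator_strip abs_mult)
    show "integrable lborel (\<lambda>y. LINT x|lborel. norm (?F (case (y, x) of (y, x) \<Rightarrow> Complex x y)))"
      unfolding norm_eq using integrable_abs[OF f] by simp
    show "AE y in lborel. integrable lborel (\<lambda>x. ?F (case (y, x) of (y, x) \<Rightarrow> Complex x y))"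
      using \<open>\<gamma> > 0\<close> by (simp add: indicator_strip)
  qed simp
  then have "integrable lborel ?F"
    by (subst lborel_complex_eq_distr) (simp add: integrable_distr_eq)
  then show ?thesis by (simp add: set_integrable_def)
qed

text \<open>Contour integrals deliver gauge integrals over a closed interval, while Fubini on the
  strip asks for Lebesgue integrals over a half-open one. Continuity gives absolute integrability,
  and the lost endpoint is null.\<close>

lemma set_integral_Ioc_eq_has_integral:
  fixes F :: "real \<Rightarrow> 'a::euclidean_space"
  assumes cont: "continuous_on {a..b} F" and F: "(F has_integral I) {a..b}"
  shows "(LINT x:{a<..b}|lborel. F x) = I"
proof -
  have "set_integrable lborel {a<..b} F"
    by (rule set_integrable_subset[OF borel_integrable_atLeastAtMost'[OF cont]]) auto
  then have "(LINT x:{a<..b}|lborel. F x) = integral {a<..b} F"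
    by (rule set_borel_integral_eq_integral)
  moreover have "(F has_integral I) {a<..b}"
    by (rule has_integral_spike_set_eq[THEN iffD1, OF _ _ F]) (auto intro: negligible_subset[of "{a}"])
  ultimately show ?thesis by (simp add: integral_unique)
qed

lemma has_bochner_integral_gaussian:
  "has_bochner_integral lborel (\<lambda>y. exp (- 2 * (y + b)\<^sup>2)) (sqrt (pi / 2))"
proof -
  \<comment> \<open>The normal density of mean \<open>- b\<close> and standard deviation 1/2, whose
    normalizing factor is the inverse of \<open>sqrt (pi / 2)\<close>.\<close>
  have eq: "exp (- 2 * (y + b)\<^sup>2) = sqrt (pi / 2) * normal_density (- b) (1 / 2) y" for y
    by (simp add: normal_density_def power2_eq_square)
  show ?thesis
    unfolding has_bochner_integral_iff eq by simp
qed

section \<open>The space $L^2(S)$: Bessel's inequality and Fatou's lemma\<close>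

lemma L2_on_scale:
  assumes "u \<in> L2_on S"
  shows "(\<lambda>z. c * u z) \<in> L2_on S"
proof -
  have "(\<lambda>z. c * (indicator S z *\<^sub>R u z)) \<in> borel_measurable lborel"
    using assms by (intro borel_measurable_times) (auto simp: L2_on_def set_borel_measurable_def)
  moreover have "set_integrable lborel S (\<lambda>z. (cmod c)\<^sup>2 * (cmod (u z))\<^sup>2)"
    using assms by (intro set_integrable_mult_right) (auto simp: L2_on_def)
  ultimately show ?thesis
    by (simp add: L2_on_def set_borel_measurable_def norm_mult power_mult_distrib)
qed

lemma L2_on_add:
  assumes u: "u \<in> L2_on S" and v: "v \<in> L2_on S"
  shows "(\<lambda>z. u z + v z) \<in> L2_on S"
proof -
  have um: "(\<lambda>z. indicator S z *\<^sub>R u z) \<in> borel_measurable lborel"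
    and vm: "(\<lambda>z. indicator S z *\<^sub>R v z) \<in> borel_measurable lborel"
    using u v by (auto simp: L2_on_def set_borel_measurable_def)
  have m: "(\<lambda>z. indicator S z *\<^sub>R (u z + v z)) \<in> borel_measurable lborel"
    using borel_measurable_add[OF um vm] by (simp add: scaleR_add_right)
  have "integrable lborel (\<lambda>z. 2 * (indicator S z * (cmod (u z))\<^sup>2) + 2 * (indicator S z * (cmod (v z))\<^sup>2))"
    using u v by (auto simp: L2_on_def set_integrable_def)
  then have "integrable lborel (\<lambda>z. indicator S z * (cmod (u z + v z))\<^sup>2)"
  proof (rule Bochner_Integration.integrable_bound)
    have "(\<lambda>z. (cmod (indicator S z *\<^sub>R (u z + v z)))\<^sup>2) \<in> borel_measurable lborel"
      using m by measurable
    also have "(\<lambda>z. (cmod (indicator S z *\<^sub>R (u z + v z)))\<^sup>2) = (\<lambda>z. indicator S z * (cmod (u z + v z))\<^sup>2)"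
      by (auto simp: indicator_def)
    finally show "(\<lambda>z. indicator S z * (cmod (u z + v z))\<^sup>2) \<in> borel_measurable lborel" .
    have "(cmod (u z + v z))\<^sup>2 \<le> 2 * (cmod (u z))\<^sup>2 + 2 * (cmod (v z))\<^sup>2" for z
    proof -
      have "(cmod (u z + v z))\<^sup>2 \<le> (cmod (u z) + cmod (v z))\<^sup>2"
        by (intro power_mono norm_triangle_ineq) simp
      also have "\<dots> \<le> 2 * (cmod (u z))\<^sup>2 + 2 * (cmod (v z))\<^sup>2"
        using sum_squares_bound[of "cmod (u z)" "cmod (v z)"] by (simp add: power2_sum)
      finally show ?thesis .
    qed
    then show "AE z in lborel. norm (indicator S z * (cmod (u z + v z))\<^sup>2) \<le>
        norm (2 * (indicator S z * (cmod (u z))\<^sup>2) + 2 * (indicator S z * (cmod (v z))\<^sup>2))"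
      by (auto simp: indicator_def)
  qed
  with m show ?thesis
    by (simp add: L2_on_def set_borel_measurable_def set_integrable_def)
qed

lemma L2_on_zero [simp]: "(\<lambda>z. 0) \<in> L2_on S"
  by (simp add: L2_on_def set_borel_measurable_def set_integrable_def)

lemma L2_on_diff:
  assumes "u \<in> L2_on S" "v \<in> L2_on S"
  shows "(\<lambda>z. u z - v z) \<in> L2_on S"
  using L2_on_add[OF assms(1) L2_on_scale[OF assms(2), of "- 1"]] by simp

lemma L2_on_sum:
  assumes "\<And>n. n \<in> F \<Longrightarrow> e n \<in> L2_on S"
  shows "(\<lambda>z. \<Sum>n\<in>F. c n * e n z) \<in> L2_on S"
  using assms
  by (induction F rule: infinite_finite_induct) (auto intro!: L2_on_add L2_on_scale)

lemma L2_inner_integrable: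
  assumes u: "u \<in> L2_on S" and v: "v \<in> L2_on S"
  shows "set_integrable lborel S (\<lambda>z. u z * cnj (v z))"
proof -
  have um: "(\<lambda>z. indicator S z *\<^sub>R u z) \<in> borel_measurable lborel"
    and vm: "(\<lambda>z. indicator S z *\<^sub>R v z) \<in> borel_measurable lborel"
    using u v by (auto simp: L2_on_def set_borel_measurable_def)
  have cnj_meas: "cnj \<in> borel_measurable borel"
    by (intro borel_measurable_continuous_onI continuous_intros)
  have "(\<lambda>z. (indicator S z *\<^sub>R u z) * cnj (indicator S z *\<^sub>R v z)) \<in> borel_measurable lborel"
    using um measurable_compose[OF vm cnj_meas] by (rule borel_measurable_times)
  also have "(\<lambda>z. (indicator S z *\<^sub>R u z) * cnj (indicator S z *\<^sub>R v z)) = (\<lambda>z. indicator S z *\<^sub>R (u z * cnj (v z)))"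
    by (auto simp: indicator_def)
  finally have m: "(\<lambda>z. indicator S z *\<^sub>R (u z * cnj (v z))) \<in> borel_measurable lborel" .
  have "integrable lborel (\<lambda>z. (indicator S z * (cmod (u z))\<^sup>2) + (indicator S z * (cmod (v z))\<^sup>2))"
    using u v by (auto simp: L2_on_def set_integrable_def)
  then show ?thesis
    unfolding set_integrable_def
  proof (rule Bochner_Integration.integrable_bound[OF _ m])
    have "cmod (u z) * cmod (v z) \<le> (cmod (u z))\<^sup>2 + (cmod (v z))\<^sup>2" for z
      using sum_squares_bound[of "cmod (u z)" "cmod (v z)"]
        mult_nonneg_nonneg[OF norm_ge_zero[of "u z"] norm_ge_zero[of "v z"]] by linarith
    then show "AE z in lborel. norm (indicator S z *\<^sub>R (u z * cnj (v z))) \<le>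
        norm ((indicator S z * (cmod (u z))\<^sup>2) + (indicator S z * (cmod (v z))\<^sup>2))"
      by (auto simp: indicator_def norm_mult)
  qed
qed

lemma L2_inner_commute: "L2_inner S v u = cnj (L2_inner S u v)"
proof -
  have "cnj (L2_inner S u v) = (LINT z|lborel. cnj (indicator S z *\<^sub>R (u z * cnj (v z))))"
    unfolding L2_inner_def set_lebesgue_integral_def by (rule Bochner_Integration.integral_cnj[symmetric])
  then show ?thesis
    by (simp add: L2_inner_def set_lebesgue_integral_def mult.commute)
qed

lemma L2_inner_add_left:
  assumes "u \<in> L2_on S" "v \<in> L2_on S" "w \<in> L2_on S"
  shows "L2_inner S (\<lambda>z. u z + v z) w = L2_inner S u w + L2_inner S v w"
  unfolding L2_inner_def distrib_right
  by (intro set_integral_add(2) L2_inner_integrable assms)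

lemma L2_inner_diff_left:
  assumes "u \<in> L2_on S" "v \<in> L2_on S" "w \<in> L2_on S"
  shows "L2_inner S (\<lambda>z. u z - v z) w = L2_inner S u w - L2_inner S v w"
  unfolding L2_inner_def left_diff_distrib
  by (intro set_integral_diff(2) L2_inner_integrable assms)

lemma L2_inner_scale_left: "L2_inner S (\<lambda>z. c * u z) w = c * L2_inner S u w"
  by (simp add: L2_inner_def mult.assoc)

lemma L2_inner_sum_left:
  assumes "\<And>n. n \<in> F \<Longrightarrow> e n \<in> L2_on S" "w \<in> L2_on S"
  shows "L2_inner S (\<lambda>z. \<Sum>n\<in>F. c n * e n z) w = (\<Sum>n\<in>F. c n * L2_inner S (e n) w)"
  using assms
proof (induction F rule: infinite_finite_induct)
  case (insert n F)
  then have "L2_inner S (\<lambda>z. c n * e n z + (\<Sum>n\<in>F. c n * e n z)) w =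
      c n * L2_inner S (e n) w + L2_inner S (\<lambda>z. \<Sum>n\<in>F. c n * e n z) w"
    by (subst L2_inner_add_left) (auto intro!: L2_on_scale L2_on_sum simp: L2_inner_scale_left)
  then show ?case using insert by simp
qed (simp_all add: L2_inner_def)

lemma L2_norm_nonneg [simp]: "L2_norm S u \<ge> 0"
  unfolding L2_norm_def set_lebesgue_integral_def by (intro real_sqrt_ge_zero integral_nonneg_AE) auto

lemma L2_orthonormalD:
  assumes "L2_orthonormal S e"
  shows "L2_inner S (e m) (e n) = (if m = n then 1 else 0)"
  using assms by (simp add: L2_orthonormal_def)

lemma L2_norm_sum_orthonormal:
  assumes e: "L2_orthonormal S e" and F: "finite F"
  shows "(L2_norm S (\<lambda>z. \<Sum>n\<in>F. c n * e n z))\<^sup>2 = (\<Sum>n\<in>F. (cmod (c n))\<^sup>2)"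
proof -
  have eL: "e n \<in> L2_on S" for n using e by (simp add: L2_orthonormal_def)
  let ?s = "\<lambda>z. \<Sum>n\<in>F. c n * e n z"
  have s: "?s \<in> L2_on S" by (intro L2_on_sum eL)
  have "L2_inner S ?s (e m) = c m" if "m \<in> F" for m
    using that F e by (subst L2_inner_sum_left) (auto simp: eL L2_orthonormalD[OF e] if_distrib cong: if_cong)
  then have "L2_inner S (e m) ?s = cnj (c m)" if "m \<in> F" for m
    using that by (subst L2_inner_commute) simp
  then have "L2_inner S ?s ?s = (\<Sum>n\<in>F. c n * cnj (c n))"
    by (subst L2_inner_sum_left) (auto simp: eL s)
  also have "\<dots> = of_real (\<Sum>n\<in>F. (cmod (c n))\<^sup>2)"
    unfolding of_real_sum complex_norm_square ..
  finally show ?thesis by (simp only: L2_inner_self of_real_eq_iff)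
qed

text \<open>The remainder \<open>d\<close> is orthogonal to the projection \<open>s\<close>, so its
  squared norm is exactly the difference of the two sides.\<close>

lemma L2_bessel:
  assumes e: "L2_orthonormal S e" and F: "finite F" and u: "u \<in> L2_on S"
  shows "(\<Sum>n\<in>F. (cmod (L2_inner S u (e n)))\<^sup>2) \<le> (L2_norm S u)\<^sup>2"
proof -
  have eL: "e n \<in> L2_on S" for n using e by (simp add: L2_orthonormal_def)
  define c where "c n = L2_inner S u (e n)" for n
  define s where "s z = (\<Sum>n\<in>F. c n * e n z)" for z
  have s: "s \<in> L2_on S" unfolding s_def by (intro L2_on_sum eL)
  define d where "d z = u z - s z" for z
  have d: "d \<in> L2_on S" unfolding d_def by (intro L2_on_diff u s)
  have "L2_inner S s (e m) = c m" if "m \<in> F" for m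
    unfolding s_def using that F e by (subst L2_inner_sum_left) (auto simp: eL L2_orthonormalD[OF e] if_distrib cong: if_cong)
  then have "L2_inner S d (e m) = 0" if "m \<in> F" for m
    unfolding d_def using that by (subst L2_inner_diff_left) (auto simp: eL u s c_def)
  then have "L2_inner S (e m) d = 0" if "m \<in> F" for m
    using that by (subst L2_inner_commute) simp
  then have sd: "L2_inner S s d = 0"
    unfolding s_def by (subst L2_inner_sum_left) (auto simp: eL d)
  have "L2_inner S s u = (\<Sum>n\<in>F. c n * cnj (c n))"
    unfolding s_def c_def by (subst L2_inner_sum_left) (auto simp: eL u intro!: sum.cong L2_inner_commute)
  also have "\<dots> = of_real (\<Sum>n\<in>F. (cmod (c n))\<^sup>2)"
    unfolding of_real_sum complex_norm_square ..
  finally have su: "L2_inner S s u = of_real (\<Sum>n\<in>F. (cmod (c n))\<^sup>2)" .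
  have "L2_inner S d d = L2_inner S u d - L2_inner S s d"
    using L2_inner_diff_left[OF u s d] by (simp add: d_def[abs_def])
  also have "\<dots> = cnj (L2_inner S d u)"
    unfolding sd by (subst L2_inner_commute) simp
  also have "L2_inner S d u = L2_inner S u u - L2_inner S s u"
    unfolding d_def by (intro L2_inner_diff_left u s)
  finally have "complex_of_real ((L2_norm S d)\<^sup>2) =
      of_real ((L2_norm S u)\<^sup>2 - (\<Sum>n\<in>F. (cmod (c n))\<^sup>2))"
    unfolding su L2_inner_self by simp
  then have "(L2_norm S d)\<^sup>2 = (L2_norm S u)\<^sup>2 - (\<Sum>n\<in>F. (cmod (c n))\<^sup>2)"
    by (simp only: of_real_eq_iff)
  then show ?thesis
    unfolding c_def by (metis diff_ge_0_iff_ge zero_le_power2)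
qed

text \<open>The bound is asked for only eventually, as Cauchy estimates hold from some index on.
  Membership of the limit is part of the conclusion: it is what places the limit of a Cauchy
  sequence in L^2.\<close>

lemma L2_fatou:
  assumes f: "\<And>k. f k \<in> L2_on S" and lim: "\<And>z. z \<in> S \<Longrightarrow> (\<lambda>k. f k z) \<longlonglongrightarrow> g z"
    and bound: "\<forall>\<^sub>F k in sequentially. L2_norm S (f k) \<le> B"
  shows "g \<in> L2_on S" and "L2_norm S g \<le> B"
proof -
  \<comment> \<open>A single index with the bound shows that \<open>B\<close> is nonnegative, which
    permits the return from squares at the end.\<close>
  obtain k where "L2_norm S (f k) \<le> B"
    using bound by (auto simp: eventually_sequentially)
  then have B: "B \<ge> 0" using L2_norm_nonneg[of S "f k"] by linarith
  have lim': "(\<lambda>k. indicator S z *\<^sub>R f k z) \<longlonglongrightarrow> indicator S z *\<^sub>R g z" for z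
    using lim[of z] by (cases "z \<in> S") auto
  have fm: "(\<lambda>z. indicator S z *\<^sub>R f k z) \<in> borel_measurable lborel" for k
    using f[of k] by (simp add: L2_on_def set_borel_measurable_def)
  have gm: "(\<lambda>z. indicator S z *\<^sub>R g z) \<in> borel_measurable lborel"
    by (rule borel_measurable_LIMSEQ_metric[OF fm lim'])
  have sq: "indicator S z *\<^sub>R (cmod w)\<^sup>2 = (cmod (indicator S z *\<^sub>R w))\<^sup>2" for z w
    by (auto simp: indicator_def)
  have int_f: "integrable lborel (\<lambda>z. (cmod (indicator S z *\<^sub>R f k z))\<^sup>2)" for k
    using f[of k] unfolding L2_on_def set_integrable_def sq by simp
  have "(\<integral>\<^sup>+z. ennreal ((cmod (indicator S z *\<^sub>R f k z))\<^sup>2) \<partial>lborel) = ennreal ((L2_norm S (f k))\<^sup>2)" for k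
    by (subst nn_integral_eq_integral[OF int_f])
       (auto simp: L2_norm_def set_lebesgue_integral_def sq integral_nonneg_AE simp del: norm_scaleR real_scaleR_def)
  then have ev: "\<forall>\<^sub>F k in sequentially. (\<integral>\<^sup>+z. ennreal ((cmod (indicator S z *\<^sub>R f k z))\<^sup>2) \<partial>lborel) \<le> ennreal (B\<^sup>2)"
    using bound by (auto elim!: eventually_mono intro!: ennreal_leI power_mono)
  have "(\<lambda>k. ennreal ((cmod (indicator S z *\<^sub>R f k z))\<^sup>2)) \<longlonglongrightarrow> ennreal ((cmod (indicator S z *\<^sub>R g z))\<^sup>2)" for z
    by (intro tendsto_ennrealI tendsto_power tendsto_norm lim')
  then have "(\<integral>\<^sup>+z. ennreal ((cmod (indicator S z *\<^sub>R g z))\<^sup>2) \<partial>lborel) =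
      (\<integral>\<^sup>+z. liminf (\<lambda>k. ennreal ((cmod (indicator S z *\<^sub>R f k z))\<^sup>2)) \<partial>lborel)"
    by (intro nn_integral_cong lim_imp_Liminf[symmetric]) auto
  also have "\<dots> \<le> liminf (\<lambda>k. \<integral>\<^sup>+z. ennreal ((cmod (indicator S z *\<^sub>R f k z))\<^sup>2) \<partial>lborel)"
    by (intro nn_integral_liminf measurable_compose[OF fm]) measurable
  also have "\<dots> \<le> limsup (\<lambda>k. \<integral>\<^sup>+z. ennreal ((cmod (indicator S z *\<^sub>R f k z))\<^sup>2) \<partial>lborel)"
    by (intro Liminf_le_Limsup) simp
  also have "\<dots> \<le> ennreal (B\<^sup>2)"
    by (rule Limsup_bounded[OF ev])
  finally have le: "(\<integral>\<^sup>+z. ennreal ((cmod (indicator S z *\<^sub>R g z))\<^sup>2) \<partial>lborel) \<le> ennreal (B\<^sup>2)" .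
  have int_g: "integrable lborel (\<lambda>z. (cmod (indicator S z *\<^sub>R g z))\<^sup>2)"
  proof (rule integrableI_nonneg)
    show "(\<lambda>z. (cmod (indicator S z *\<^sub>R g z))\<^sup>2) \<in> borel_measurable lborel"
      using gm by measurable
    show "(\<integral>\<^sup>+z. ennreal ((cmod (indicator S z *\<^sub>R g z))\<^sup>2) \<partial>lborel) < \<infinity>"
      using le by (rule le_less_trans) simp
  qed simp
  then show "g \<in> L2_on S"
    using gm unfolding L2_on_def set_integrable_def set_borel_measurable_def sq by simp
  have "(\<integral>z. (cmod (indicator S z *\<^sub>R g z))\<^sup>2 \<partial>lborel) \<le> B\<^sup>2"
    using le by (subst (asm) nn_integral_eq_integral[OF int_g]) (auto simp: ennreal_le_iff)
  then show "L2_norm S g \<le> B"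
    unfolding L2_norm_def set_lebesgue_integral_def sq using B by (intro real_le_lsqrt) auto
qed

section \<open>The family of the weighted Fourier modes\<close>

text \<open>The exponent z^2/2 - |z|^2/2, factored so that \<open>z - cnj z\<close> stands out,
  which is purely imaginary and invariant under real translations.\<close>

definition fock_weight :: "complex \<Rightarrow> complex" where
  "fock_weight z = exp (z * (z - cnj z) / 2)"

lemma fock_weight_eq: "fock_weight z = exp (- of_real ((cmod z)\<^sup>2) / 2) * exp (z\<^sup>2 / 2)"
  unfolding fock_weight_def exp_add[symmetric] complex_norm_square
  by (simp add: power2_eq_square algebra_simps diff_divide_distrib)

lemma fock_weight_nonzero [simp]: "fock_weight z \<noteq> 0"
  by (simp add: fock_weight_def)

lemma norm_fock_weight: "cmod (fock_weight z) = exp (- (Im z)\<^sup>2)"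
  by (simp add: fock_weight_def power2_eq_square)

text \<open>A real shift adds \<gamma> (z - cnj z)/2 to the exponent of the weight, the opposite of
  the exponent of the magnetic factor. Thus the weight is a fixed point of R_\<gamma>.\<close>

lemma fock_weight_translate:
  "exp ((of_real \<gamma> * cnj z - cnj (of_real \<gamma>) * z) / 2) * fock_weight (z + of_real \<gamma>) = fock_weight z"
  unfolding fock_weight_def exp_add[symmetric]
  by (rule arg_cong[of _ _ exp]) (simp add: field_simps)

lemma fock_periodic_factor:
  assumes "u \<in> fock_periodic \<gamma>"
  obtains g where "g holomorphic_on UNIV" "\<And>z. g (z + of_real \<gamma>) = g z"
    "\<And>z. u z = fock_weight z * g z"
proof -
  from assms obtain f where f: "f holomorphic_on UNIV"
    and u: "\<And>z. u z = exp (- of_real ((cmod z)\<^sup>2) / 2) * f z"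
    and inv: "magnetic_translation (of_real \<gamma>) u = u"
    by (auto simp: fock_periodic_def fock_temperate_def)
  define g where "g z = f z * exp (- (z\<^sup>2) / 2)" for z
  have ug: "u z = fock_weight z * g z" for z
    by (simp add: u g_def fock_weight_eq exp_minus)
  show ?thesis
  proof (rule that[of g])
    show "g holomorphic_on UNIV"
      unfolding g_def using f by (auto intro!: holomorphic_intros)
    show "g (z + of_real \<gamma>) = g z" for z
    proof -
      have "fock_weight z * g (z + of_real \<gamma>) = magnetic_translation (of_real \<gamma>) u z"
        unfolding magnetic_translation_def ug
        by (subst fock_weight_translate[of \<gamma>, symmetric]) (simp add: mult_ac)
      then show ?thesis by (simp add: inv ug)
    qed
  qed (rule ug)
qed

section \<open>The temperate and the periodic functions as vector spaces\<close>

lemma fock_temperate_boundedI: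
  assumes f: "f holomorphic_on UNIV" and u: "\<And>z. u z = exp (- of_real ((cmod z)\<^sup>2) / 2) * f z"
    and bound: "\<And>z. cmod (u z) \<le> B"
  shows "u \<in> fock_temperate"
proof -
  \<comment> \<open>\<open>x powr 0\<close> is 1 only for nonzero \<open>x\<close>, so the bracket
    has to be shown not to vanish.\<close>
  have "\<forall>z. cmod (u z) \<le> B * japanese_bracket z powr 0"
    using bound by (simp add: japanese_bracket_def add_nonneg_eq_0_iff)
  then show ?thesis
    unfolding fock_temperate_def using f u by blast
qed

lemma fock_temperateE:
  assumes "u \<in> fock_temperate"
  obtains f C M where "f holomorphic_on UNIV"
    "\<forall>z. u z = exp (- of_real ((cmod z)\<^sup>2) / 2) * f z"
    "\<forall>z. cmod (u z) \<le> C * japanese_bracket z powr M"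
  using assms unfolding fock_temperate_def by blast

lemma fock_temperate_scale:
  assumes "u \<in> fock_temperate"
  shows "(\<lambda>z. c * u z) \<in> fock_temperate"
proof -
  obtain f C M where f: "f holomorphic_on UNIV"
    and u: "\<forall>z. u z = exp (- of_real ((cmod z)\<^sup>2) / 2) * f z"
    and bound: "\<forall>z. cmod (u z) \<le> C * japanese_bracket z powr M"
    using fock_temperateE[OF assms] by blast
  have "(\<lambda>z. c * f z) holomorphic_on UNIV"
    using f by (intro holomorphic_intros)
  moreover have "\<forall>z. c * u z = exp (- of_real ((cmod z)\<^sup>2) / 2) * (c * f z)"
    by (simp add: u)
  moreover have "\<forall>z. cmod (c * u z) \<le> (cmod c * C) * japanese_bracket z powr M"
    using bound by (simp add: norm_mult mult.assoc mult_left_mono)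
  ultimately show ?thesis unfolding fock_temperate_def by blast
qed

lemma fock_temperate_add:
  assumes "u \<in> fock_temperate" "v \<in> fock_temperate"
  shows "(\<lambda>z. u z + v z) \<in> fock_temperate"
proof -
  obtain f C M where f: "f holomorphic_on UNIV"
    and u: "\<forall>z. u z = exp (- of_real ((cmod z)\<^sup>2) / 2) * f z"
    and ub: "\<forall>z. cmod (u z) \<le> C * japanese_bracket z powr M"
    using fock_temperateE[OF assms(1)] by blast
  obtain g D L where g: "g holomorphic_on UNIV"
    and v: "\<forall>z. v z = exp (- of_real ((cmod z)\<^sup>2) / 2) * g z"
    and vb: "\<forall>z. cmod (v z) \<le> D * japanese_bracket z powr L"
    using fock_temperateE[OF assms(2)] by blast
  have bracket: "1 \<le> japanese_bracket z" for z
    by (simp add: japanese_bracket_def)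
  \<comment> \<open>The bracket is at least 1, so the larger exponent serves both bounds; absolute
    values spare a discussion of the signs of \<open>C\<close> and \<open>D\<close>.\<close>
  have "cmod (u z + v z) \<le> (\<bar>C\<bar> + \<bar>D\<bar>) * japanese_bracket z powr (max M L)" for z
  proof -
    have "C * japanese_bracket z powr M \<le> \<bar>C\<bar> * japanese_bracket z powr (max M L)"
      "D * japanese_bracket z powr L \<le> \<bar>D\<bar> * japanese_bracket z powr (max M L)"
      using bracket by (auto intro!: mult_mono powr_mono)
    then show ?thesis
      using norm_triangle_ineq[of "u z" "v z"] ub[rule_format, of z] vb[rule_format, of z] by (simp add: distrib_right)
  qed
  moreover have "(\<lambda>z. f z + g z) holomorphic_on UNIV"
    using f g by (intro holomorphic_intros)
  moreover have "\<forall>z. u z + v z = exp (- of_real ((cmod z)\<^sup>2) / 2) * (f z + g z)"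
    by (simp add: u v algebra_simps)
  ultimately show ?thesis unfolding fock_temperate_def by blast
qed

lemma fock_periodic_scale:
  assumes "u \<in> fock_periodic \<gamma>"
  shows "(\<lambda>z. c * u z) \<in> fock_periodic \<gamma>"
  using assms by (auto simp: fock_periodic_def magnetic_translation_def fun_eq_iff mult.left_commute
      intro!: fock_temperate_scale)

lemma fock_periodic_add:
  assumes "u \<in> fock_periodic \<gamma>" "v \<in> fock_periodic \<gamma>"
  shows "(\<lambda>z. u z + v z) \<in> fock_periodic \<gamma>"
  using assms by (auto simp: fock_periodic_def magnetic_translation_def fun_eq_iff distrib_left
      intro!: fock_temperate_add)

lemma fock_periodic_diff:
  assumes "u \<in> fock_periodic \<gamma>" "v \<in> fock_periodic \<gamma>"
  shows "(\<lambda>z. u z - v z) \<in> fock_periodic \<gamma>"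
  using fock_periodic_add[OF assms(1) fock_periodic_scale[OF assms(2), of "- 1"]] by simp

section \<open>Normalization, size and membership of the family\<close>

definition psi_const :: "real \<Rightarrow> real" where
  "psi_const \<gamma> = (2 / (pi * \<gamma>\<^sup>2)) powr (1 / 4)"

lemma psi_const_pos: "\<gamma> > 0 \<Longrightarrow> psi_const \<gamma> > 0"
  by (simp add: psi_const_def)

text \<open>The factor \<open>\<gamma>\<close> is the integral over a period and
  \<open>sqrt (pi / 2)\<close> the Gaussian integral in y: the constant is the one that gives every
  member norm 1.\<close>

lemma psi_const_normalized:
  assumes "\<gamma> > 0"
  shows "\<gamma> * ((psi_const \<gamma>)\<^sup>2 * sqrt (pi / 2)) = 1"
proof -
  have "(psi_const \<gamma>)\<^sup>2 = (2 / (pi * \<gamma>\<^sup>2)) powr (1 / 2)"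
    unfolding psi_const_def power2_eq_square powr_add[symmetric] by simp
  also have "\<dots> = sqrt (2 / (pi * \<gamma>\<^sup>2))"
    using assms by (subst powr_half_sqrt) auto
  finally show ?thesis
    using assms by (simp add: real_sqrt_divide real_sqrt_mult field_simps)
qed

lemma psi_eq_weight_mode:
  "psi \<gamma> n z = of_real (psi_const \<gamma> * exp (- (pi * of_int n / \<gamma>)\<^sup>2)) * (fock_weight z * fourier_mode \<gamma> n z)"
proof -
  have "- of_real (pi\<^sup>2 * (of_int n)\<^sup>2 / \<gamma>\<^sup>2) + 2 * \<i> * of_int n * of_real pi / of_real \<gamma> * z
      + z\<^sup>2 / 2 - of_real ((cmod z)\<^sup>2) / 2 =
    complex_of_real (- (pi * of_int n / \<gamma>)\<^sup>2) + ((- of_real ((cmod z)\<^sup>2) / 2 + z\<^sup>2 / 2)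
      + 2 * of_real pi * \<i> * of_int n * z / of_real \<gamma>)"
    by (simp add: power_divide power_mult_distrib)
  then show ?thesis
    unfolding psi_def psi_const_def fock_weight_eq fourier_mode_def
    by (simp only: exp_add of_real_mult exp_of_real mult.assoc)
qed

lemma norm_fourier_mode: "cmod (fourier_mode \<gamma> n z) = exp (- 2 * pi * of_int n * Im z / \<gamma>)"
  by (simp add: fourier_mode_def)

text \<open>The weight, the mode and the scalar factor contribute the three terms of a complete
  square. Hence each member peaks on the line Im z = -\<pi> n/\<gamma>, with the same height for all
  \<open>n\<close>.\<close>

lemma norm_psi:
  assumes "\<gamma> > 0"
  shows "cmod (psi \<gamma> n z) = psi_const \<gamma> * exp (- (Im z + pi * of_int n / \<gamma>)\<^sup>2)"
proof -
  have "- (Im z + pi * of_int n / \<gamma>)\<^sup>2 =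
      - (pi * of_int n / \<gamma>)\<^sup>2 + (- (Im z)\<^sup>2 + - 2 * pi * of_int n * Im z / \<gamma>)"
    by (simp add: power2_sum)
  then show ?thesis
    using psi_const_pos[OF assms] unfolding psi_eq_weight_mode
    by (simp only: norm_mult norm_of_real norm_fock_weight norm_fourier_mode exp_add abs_mult abs_of_pos abs_exp_cancel mult.assoc)
qed

lemma continuous_on_psi:
  assumes "\<gamma> > 0"
  shows "continuous_on A (psi \<gamma> n)"
  unfolding psi_eq_weight_mode[abs_def] fock_weight_def fourier_mode_def
  using assms by (auto intro!: continuous_intros)

lemma psi_in_L2:
  assumes \<gamma>: "\<gamma> > 0"
  shows "psi \<gamma> n \<in> L2_on (strip \<gamma>)"
proof -
  have [measurable]: "psi \<gamma> n \<in> borel_measurable borel"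
    by (intro borel_measurable_continuous_onI continuous_on_psi \<gamma>)
  have "set_integrable lborel (strip \<gamma>) (\<lambda>z. (psi_const \<gamma>)\<^sup>2 * exp (- 2 * (Im z + pi * of_int n / \<gamma>)\<^sup>2))"
    using has_bochner_integral_gaussian[of "pi * of_int n / \<gamma>"] \<gamma>
    by (intro set_integrable_mult_right set_integrable_strip_Im) (auto simp: has_bochner_integral_iff)
  moreover have "(cmod (psi \<gamma> n z))\<^sup>2 = (psi_const \<gamma>)\<^sup>2 * exp (- 2 * (Im z + pi * of_int n / \<gamma>)\<^sup>2)" for z
    by (simp add: norm_psi[OF \<gamma>] power_mult_distrib exp_double[symmetric])
  ultimately show ?thesis
    by (simp add: L2_on_def set_borel_measurable_def)
qed

lemma psi_in_fock_periodic:
  assumes \<gamma>: "\<gamma> > 0"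
  shows "psi \<gamma> n \<in> fock_periodic \<gamma>"
proof -
  define f where "f z = of_real (psi_const \<gamma> * exp (- (pi * of_int n / \<gamma>)\<^sup>2)) * (exp (z\<^sup>2 / 2) * fourier_mode \<gamma> n z)" for z
  have "psi \<gamma> n \<in> fock_temperate"
  proof (rule fock_temperate_boundedI)
    show "f holomorphic_on UNIV"
      unfolding f_def fourier_mode_def using \<gamma> by (auto intro!: holomorphic_intros)
    show "psi \<gamma> n z = exp (- of_real ((cmod z)\<^sup>2) / 2) * f z" for z
      by (simp add: psi_eq_weight_mode f_def fock_weight_eq)
    show "cmod (psi \<gamma> n z) \<le> psi_const \<gamma>" for z
      using psi_const_pos[OF \<gamma>] by (simp add: norm_psi[OF \<gamma>] mult_left_le)
  qed
  moreover have "magnetic_translation (of_real \<gamma>) (psi \<gamma> n) = psi \<gamma> n"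
  proof
    fix z
    have "magnetic_translation (of_real \<gamma>) (psi \<gamma> n) z =
        of_real (psi_const \<gamma> * exp (- (pi * of_int n / \<gamma>)\<^sup>2)) *
        ((exp ((of_real \<gamma> * cnj z - cnj (of_real \<gamma>) * z) / 2) * fock_weight (z + of_real \<gamma>)) *
          fourier_mode \<gamma> n (z + of_real \<gamma>))"
      unfolding magnetic_translation_def psi_eq_weight_mode by (simp only: mult_ac)
    also have "\<dots> = psi \<gamma> n z"
      unfolding fock_weight_translate psi_eq_weight_mode using \<gamma> by (simp add: fourier_mode_period)
    finally show "magnetic_translation (of_real \<gamma>) (psi \<gamma> n) z = psi \<gamma> n z" .
  qed
  ultimately show ?thesis by (simp add: fock_periodic_def)
qed

section \<open>Inner products with the family and the pointwise expansion\<close>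

lemma weight_mode_cnj:
  "fock_weight (Complex x y) * cnj (fock_weight (Complex x y) * fourier_mode \<gamma> n (Complex x y)) =
     of_real (exp (- 2 * y\<^sup>2 - 4 * (pi * of_int n / \<gamma>) * y)) * fourier_mode \<gamma> (- n) (Complex x y)"
proof -
  have "fock_weight (Complex x y) * cnj (fock_weight (Complex x y)) = of_real (exp (- 2 * y\<^sup>2))"
    unfolding complex_norm_square[symmetric] norm_fock_weight by (simp add: exp_double[symmetric])
  \<comment> \<open>Since cnj z = z - 2 i y, conjugation turns the mode into the one of index
    \<open>- n\<close> up to a positive factor in \<open>y\<close> alone, so the integrand will
    separate.\<close>
  moreover have "cnj (fourier_mode \<gamma> n (Complex x y)) =
      of_real (exp (- 4 * (pi * of_int n / \<gamma>) * y)) * fourier_mode \<gamma> (- n) (Complex x y)"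
    unfolding fourier_mode_def exp_cnj exp_of_real[symmetric] exp_add[symmetric]
    by (rule arg_cong[of _ _ exp]) (simp add: complex_eq_iff)
  ultimately show ?thesis
    by (simp add: mult.assoc[symmetric] exp_diff exp_minus divide_inverse)
qed

text \<open>The integral over x is a function of y times \<gamma> a, with \<open>a\<close> the same
  at every height, and the remaining integral is Gaussian. The inner product is multiplied by the
  scalar factor of \<open>psi \<gamma> n\<close>, which makes it the coefficient of the weighted
  mode; both orthonormality and the expansion rest on this formula.\<close>

lemma L2_inner_psi:
  assumes \<gamma>: "\<gamma> > 0" and u: "u \<in> L2_on (strip \<gamma>)"
    and ug: "\<And>z. u z = fock_weight z * g z" and g: "continuous_on UNIV g"
    and a: "\<And>y. ((\<lambda>x. g (Complex x y) * fourier_mode \<gamma> (- n) (Complex x y)) has_integral of_real \<gamma> * a) {- \<gamma> / 2..\<gamma> / 2}"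
  shows "L2_inner (strip \<gamma>) u (psi \<gamma> n) * of_real (psi_const \<gamma> * exp (- (pi * of_int n / \<gamma>)\<^sup>2)) = a"
proof -
  define b where "b = pi * of_int n / \<gamma>"
  define w where "w y = psi_const \<gamma> * exp (b\<^sup>2) * exp (- 2 * (y + b)\<^sup>2)" for y
  have prod: "u (Complex x y) * cnj (psi \<gamma> n (Complex x y)) =
      of_real (w y) * (g (Complex x y) * fourier_mode \<gamma> (- n) (Complex x y))" for x y
  proof -
    have "u (Complex x y) * cnj (psi \<gamma> n (Complex x y)) =
      of_real (psi_const \<gamma> * exp (- b\<^sup>2)) * g (Complex x y) *
        (fock_weight (Complex x y) * cnj (fock_weight (Complex x y) * fourier_mode \<gamma> n (Complex x y)))"
      by (simp add: ug psi_eq_weight_mode b_def mult_ac)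
    also have "\<dots> = of_real (psi_const \<gamma> * (exp (- b\<^sup>2) * exp (- 2 * y\<^sup>2 - 4 * b * y))) *
        (g (Complex x y) * fourier_mode \<gamma> (- n) (Complex x y))"
      unfolding weight_mode_cnj b_def[symmetric] by (simp add: mult_ac)
    \<comment> \<open>Completing the square. The surplus e^(b^2) cancels in the end against e^(-b^2)
      in the scalar factor of \<open>psi \<gamma> n\<close>.\<close>
    also have "exp (- b\<^sup>2) * exp (- 2 * y\<^sup>2 - 4 * b * y) = exp (b\<^sup>2) * exp (- 2 * (y + b)\<^sup>2)"
      unfolding exp_add[symmetric] by (simp add: power2_eq_square algebra_simps)
    finally show ?thesis by (simp add: w_def mult.assoc)
  qed
  have inner: "(LINT x:{- \<gamma> / 2<..\<gamma> / 2}|lborel. u (Complex x y) * cnj (psi \<gamma> n (Complex x y))) =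
      of_real (w y) * (of_real \<gamma> * a)" for y
    unfolding prod
  proof (rule set_integral_Ioc_eq_has_integral)
    have "continuous_on {- \<gamma> / 2..\<gamma> / 2} (\<lambda>x. Complex x y)"
      unfolding Complex_eq by (intro continuous_intros)
    then have "continuous_on {- \<gamma> / 2..\<gamma> / 2} (\<lambda>x. g (Complex x y))"
      by (rule continuous_on_compose2[OF g]) simp
    moreover have "continuous_on {- \<gamma> / 2..\<gamma> / 2} (\<lambda>x. fourier_mode \<gamma> (- n) (Complex x y))"
      unfolding fourier_mode_def Complex_eq using \<gamma> by (intro continuous_intros) auto
    ultimately show "continuous_on {- \<gamma> / 2..\<gamma> / 2} (\<lambda>x. of_real (w y) * (g (Complex x y) * fourier_mode \<gamma> (- n) (Complex x y)))"
      by (intro continuous_intros)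
  qed (intro has_integral_mult_right a)
  have w_int: "integral\<^sup>L lborel w = psi_const \<gamma> * exp (b\<^sup>2) * sqrt (pi / 2)"
    using has_bochner_integral_gaussian[of b] unfolding w_def by (simp add: has_bochner_integral_iff)
  have "L2_inner (strip \<gamma>) u (psi \<gamma> n) = (LINT y|lborel. of_real (w y) * (of_real \<gamma> * a))"
    unfolding L2_inner_def inner[symmetric]
    by (intro set_integral_strip L2_inner_integrable u psi_in_L2 \<gamma>)
  also have "\<dots> = of_real (integral\<^sup>L lborel w) * (of_real \<gamma> * a)"
    by simp
  finally have "L2_inner (strip \<gamma>) u (psi \<gamma> n) * of_real (psi_const \<gamma> * exp (- b\<^sup>2)) =
      of_real (\<gamma> * ((psi_const \<gamma>)\<^sup>2 * sqrt (pi / 2)) * (exp (b\<^sup>2) * exp (- b\<^sup>2))) * a"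
    unfolding w_int by (simp add: power2_eq_square mult_ac)
  also have "\<dots> = a"
    unfolding psi_const_normalized[OF \<gamma>] exp_add[symmetric] by simp
  finally show ?thesis by (simp add: b_def)
qed

text \<open>For a nonzero index the primitive is a multiple of the mode, hence periodic, and its
  values at the two ends cancel.\<close>

lemma fourier_mode_has_integral:
  assumes \<gamma>: "\<gamma> > 0"
  shows "((\<lambda>x. fourier_mode \<gamma> k (Complex x y)) has_integral of_real \<gamma> * (if k = 0 then 1 else 0)) {- \<gamma> / 2..\<gamma> / 2}"
proof (cases "k = 0")
  case True
  then show ?thesis
    using has_integral_const_real[of "1 :: complex" "- \<gamma> / 2" "\<gamma> / 2"] \<gamma>
    by (simp add: fourier_mode_def scaleR_conv_of_real)
next
  case False
  define c where "c = 2 * of_real pi * \<i> * of_int k / complex_of_real \<gamma>"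
  have c: "c \<noteq> 0" using False \<gamma> by (simp add: c_def)
  have mode: "fourier_mode \<gamma> k z = exp (c * z)" for z
    by (simp add: fourier_mode_def c_def)
  have "((\<lambda>x. exp (c * Complex x y)) has_integral
      exp (c * Complex (\<gamma> / 2) y) / c - exp (c * Complex (- \<gamma> / 2) y) / c) {- \<gamma> / 2..\<gamma> / 2}"
  proof (rule fundamental_theorem_of_calculus)
    fix x assume "x \<in> {- \<gamma> / 2..\<gamma> / 2}"
    have "((\<lambda>z. exp (c * (z + \<i> * of_real y)) / c) has_field_derivative exp (c * (of_real x + \<i> * of_real y))) (at (of_real x))"
      using c by (auto intro!: derivative_eq_intros)
    from has_vector_derivative_real_field[OF this]
    show "((\<lambda>x. exp (c * Complex x y) / c) has_vector_derivative exp (c * Complex x y)) (at x within {- \<gamma> / 2..\<gamma> / 2})"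
      by (simp add: Complex_eq has_vector_derivative_at_within)
  qed (use \<gamma> in simp)
  moreover have "Complex (- \<gamma> / 2) y + of_real \<gamma> = Complex (\<gamma> / 2) y"
    by (simp add: complex_eq_iff)
  then have "exp (c * Complex (\<gamma> / 2) y) = exp (c * Complex (- \<gamma> / 2) y)"
    using fourier_mode_period[of \<gamma> k "Complex (- \<gamma> / 2) y"] \<gamma> unfolding mode by simp
  ultimately show ?thesis using False by (simp add: mode)
qed

text \<open>Each member is the weight times a single mode, so the coefficient formula applies with
  \<open>a\<close> equal to \<open>k m\<close> or 0; dividing by the nonzero \<open>k n\<close>
  leaves the Kronecker delta.\<close>

lemma psi_orthonormal:
  assumes \<gamma>: "\<gamma> > 0"
  shows "L2_orthonormal (strip \<gamma>) (psi \<gamma>)"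
  unfolding L2_orthonormal_def
proof (intro conjI allI psi_in_L2 \<gamma>)
  fix m n
  define k where "k j = complex_of_real (psi_const \<gamma> * exp (- (pi * of_int j / \<gamma>)\<^sup>2))" for j :: int
  have k: "k j \<noteq> 0" for j using psi_const_pos[OF \<gamma>] by (simp add: k_def)
  have "L2_inner (strip \<gamma>) (psi \<gamma> m) (psi \<gamma> n) * of_real (psi_const \<gamma> * exp (- (pi * of_int n / \<gamma>)\<^sup>2)) =
      k m * (if m = n then 1 else 0)"
  proof (rule L2_inner_psi[OF \<gamma> psi_in_L2[OF \<gamma>]])
    show "psi \<gamma> m z = fock_weight z * (k m * fourier_mode \<gamma> m z)" for z
      by (simp add: psi_eq_weight_mode k_def)
    show "continuous_on UNIV (\<lambda>z. k m * fourier_mode \<gamma> m z)"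
      unfolding fourier_mode_def using \<gamma> by (intro continuous_intros) auto
    have "k m * fourier_mode \<gamma> m z * fourier_mode \<gamma> (- n) z = k m * fourier_mode \<gamma> (m - n) z" for z
      by (simp add: fourier_mode_def exp_add[symmetric] diff_divide_distrib algebra_simps)
    moreover have "k m * (of_real \<gamma> * (if m - n = 0 then 1 else 0)) = of_real \<gamma> * (k m * (if m = n then 1 else 0))"
      by simp
    ultimately show "((\<lambda>x. k m * fourier_mode \<gamma> m (Complex x y) * fourier_mode \<gamma> (- n) (Complex x y)) has_integral
        of_real \<gamma> * (k m * (if m = n then 1 else 0))) {- \<gamma> / 2..\<gamma> / 2}" for y
      using has_integral_mult_right[OF fourier_mode_has_integral[OF \<gamma>, of "m - n" y], of "k m"]
      by (simp only:)
  qed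
  then show "L2_inner (strip \<gamma>) (psi \<gamma> m) (psi \<gamma> n) = (if m = n then 1 else 0)"
    using k unfolding k_def[symmetric] by (auto split: if_splits)
qed

lemma psi_expansion:
  assumes \<gamma>: "\<gamma> > 0" and u: "u \<in> L2_on (strip \<gamma>)" "u \<in> fock_periodic \<gamma>"
  shows "(\<lambda>N. \<Sum>n\<in>{- int N..int N}. L2_inner (strip \<gamma>) u (psi \<gamma> n) * psi \<gamma> n z) \<longlonglongrightarrow> u z"
proof -
  obtain g where g: "g holomorphic_on UNIV" and per: "\<And>z. g (z + of_real \<gamma>) = g z"
    and ug: "\<And>z. u z = fock_weight z * g z"
    using fock_periodic_factor[OF u(2)] by blast
  obtain a where lim: "\<And>z. (\<lambda>N. \<Sum>n\<in>{- int N..int N}. a n * fourier_mode \<gamma> n z) \<longlonglongrightarrow> g z"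
    and a: "\<And>n y. ((\<lambda>x. g (Complex x y) * fourier_mode \<gamma> (- n) (Complex x y))
           has_integral of_real \<gamma> * a n) {- \<gamma> / 2..\<gamma> / 2}"
    using periodic_entire_fourier[OF \<gamma> g per] by blast
  have "L2_inner (strip \<gamma>) u (psi \<gamma> n) * psi \<gamma> n z = fock_weight z * (a n * fourier_mode \<gamma> n z)" for n
    unfolding L2_inner_psi[OF \<gamma> u(1) ug holomorphic_on_imp_continuous_on[OF g] a, symmetric] psi_eq_weight_mode[of _ _ z]
    by (simp only: mult_ac)
  then show ?thesis
    unfolding ug sum_distrib_left[symmetric] by (simp only: sum_distrib_left[symmetric] tendsto_mult_left[OF lim])
qed

section \<open>Completeness and density\<close>

text \<open>The sign splits the integers into two halves on which the absolute value is injective;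
  each half is dominated by one geometric series.\<close>

lemma sum_power_nat_abs_le:
  fixes q :: real and F :: "int set"
  assumes q: "0 \<le> q" "q < 1" and F: "finite F"
  shows "(\<Sum>k\<in>F. q ^ nat \<bar>k\<bar>) \<le> 2 / (1 - q)"
proof -
  have half: "(\<Sum>k\<in>A. q ^ nat \<bar>k\<bar>) \<le> 1 / (1 - q)"
    if A: "finite A" "inj_on (\<lambda>k. nat \<bar>k\<bar>) A" for A :: "int set"
  proof -
    have "(\<Sum>k\<in>A. q ^ nat \<bar>k\<bar>) = (\<Sum>i\<in>(\<lambda>k. nat \<bar>k\<bar>) ` A. q ^ i)"
      using A by (simp add: sum.reindex)
    also have "\<dots> \<le> (\<Sum>i. q ^ i)"
      using q A by (intro sum_le_suminf summable_geometric) auto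
    finally show ?thesis using q by (simp add: suminf_geometric)
  qed
  have "(\<Sum>k\<in>F. q ^ nat \<bar>k\<bar>) = (\<Sum>k\<in>F \<inter> {0..}. q ^ nat \<bar>k\<bar>) + (\<Sum>k\<in>F \<inter> {..<0}. q ^ nat \<bar>k\<bar>)"
    using F by (subst sum.union_disjoint[symmetric]) (auto intro!: sum.cong)
  also have "\<dots> \<le> 1 / (1 - q) + 1 / (1 - q)"
    using F by (intro add_mono half) (auto simp: inj_on_def)
  finally show ?thesis by simp
qed

text \<open>Uniformity in \<open>y\<close> is the point. Shifting the index by the integer nearest
  to \<open>y / \<alpha>\<close> leaves an offset of at most 1/2, and k plus such an offset has
  modulus at least |k|/2 for every integer k.\<close>

lemma gaussian_sum_bound:
  fixes \<alpha> :: real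
  assumes \<alpha>: "\<alpha> > 0"
  obtains C where "\<And>y F. finite F \<Longrightarrow> (\<Sum>n\<in>F. exp (- (y + \<alpha> * of_int n)\<^sup>2)) \<le> C"
proof -
  \<comment> \<open>From (|k|/2)^2 \<ge> |k|/4: a Gaussian term at distance at least \<alpha> |k|/2
    from the centre is at most q^|k|.\<close>
  define q where "q = exp (- \<alpha>\<^sup>2 / 4)"
  have q: "0 \<le> q" "q < 1" using \<alpha> by (auto simp: q_def)
  have "(\<Sum>n\<in>F. exp (- (y + \<alpha> * of_int n)\<^sup>2)) \<le> 2 / (1 - q)" if F: "finite F" for y and F :: "int set"
  proof -
    define t where "t = y / \<alpha>"
    define m where "m = round t"
    have tm: "\<bar>t - of_int m\<bar> \<le> 1 / 2"
      unfolding m_def using of_int_round_abs_le[of t] by (simp add: abs_minus_commute)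
    have "exp (- (y + \<alpha> * of_int n)\<^sup>2) \<le> q ^ nat \<bar>n + m\<bar>" for n
    proof -
      define k where "k = n + m"
      have half: "\<bar>real_of_int k\<bar> / 2 \<le> \<bar>of_int n + t\<bar>"
      proof (cases "k = 0")
        case False
        then have "1 \<le> \<bar>real_of_int k\<bar>" by linarith
        moreover have "of_int n + t = of_int k + (t - of_int m)" by (simp add: k_def)
        ultimately show ?thesis using tm by linarith
      qed simp
      have "\<bar>k\<bar> \<le> k\<^sup>2"
        using mult_left_mono[of 1 "\<bar>k\<bar>" "\<bar>k\<bar>"] by (cases "k = 0") (auto simp: power2_eq_square)
      then have "real_of_int \<bar>k\<bar> \<le> (real_of_int k)\<^sup>2"
        by (metis of_int_le_iff of_int_power)
      also have "\<dots> = 4 * (\<bar>real_of_int k\<bar> / 2)\<^sup>2"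
        by (simp add: power_divide)
      also have "\<dots> \<le> 4 * \<bar>of_int n + t\<bar>\<^sup>2"
        using half by (intro mult_left_mono power_mono) auto
      finally have "\<alpha>\<^sup>2 * (real_of_int \<bar>k\<bar> / 4) \<le> \<alpha>\<^sup>2 * (of_int n + t)\<^sup>2"
        by (intro mult_left_mono) auto
      also have "\<dots> = (y + \<alpha> * of_int n)\<^sup>2"
        using \<alpha> unfolding power_mult_distrib[symmetric] t_def by (simp add: algebra_simps)
      finally have "exp (- (y + \<alpha> * of_int n)\<^sup>2) \<le> exp (of_nat (nat \<bar>k\<bar>) * (- \<alpha>\<^sup>2 / 4))"
        by (simp add: mult.commute)
      also have "\<dots> = q ^ nat \<bar>k\<bar>"
        unfolding q_def by (rule exp_of_nat_mult)
      finally show ?thesis by (simp add: k_def)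
    qed
    then have "(\<Sum>n\<in>F. exp (- (y + \<alpha> * of_int n)\<^sup>2)) \<le> (\<Sum>n\<in>F. q ^ nat \<bar>n + m\<bar>)"
      by (intro sum_mono)
    also have "\<dots> = (\<Sum>k\<in>(\<lambda>n. n + m) ` F. q ^ nat \<bar>k\<bar>)"
      by (simp add: sum.reindex)
    also have "\<dots> \<le> 2 / (1 - q)"
      using F by (intro sum_power_nat_abs_le q) auto
    finally show ?thesis .
  qed
  then show ?thesis using that by blast
qed

text \<open>The estimate holds at every point of the plane although the norm sees only the strip;
  vanishing norm therefore forces the function itself to vanish everywhere.\<close>

lemma fock_periodic_pointwise_bound:
  assumes \<gamma>: "\<gamma> > 0"
  obtains C where "C > 0"
    "\<And>u z. u \<in> L2_on (strip \<gamma>) \<inter> fock_periodic \<gamma> \<Longrightarrow> cmod (u z) \<le> C * L2_norm (strip \<gamma>) u"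
proof -
  obtain B where B: "\<And>y F. finite F \<Longrightarrow> (\<Sum>n\<in>F. exp (- (y + pi / \<gamma> * of_int n)\<^sup>2)) \<le> B"
    using gaussian_sum_bound[of "pi / \<gamma>"] \<gamma> by auto
  define K where "K = psi_const \<gamma>"
  have K: "K > 0" using psi_const_pos[OF \<gamma>] by (simp add: K_def)
  \<comment> \<open>\<open>\<bar>B\<bar> + 1\<close> in place of \<open>B\<close> makes the constant
    strictly positive, so that it may later be divided by.\<close>
  have le: "cmod (u z) \<le> (K * (\<bar>B\<bar> + 1)) * L2_norm (strip \<gamma>) u"
    if u: "u \<in> L2_on (strip \<gamma>)" "u \<in> fock_periodic \<gamma>" for u z
  proof -
    let ?c = "\<lambda>n. L2_inner (strip \<gamma>) u (psi \<gamma> n)"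
    \<comment> \<open>Bessel for a single index. A bound on the coefficients uniform in
      \<open>n\<close> is enough, as the moduli of the family are summable at each point.\<close>
    have c: "cmod (?c n) \<le> L2_norm (strip \<gamma>) u" for n
      using L2_bessel[OF psi_orthonormal[OF \<gamma>] _ u(1), of "{n}"]
      by (intro power2_le_imp_le[OF _ L2_norm_nonneg]) simp
    have "cmod (\<Sum>n\<in>{- int N..int N}. ?c n * psi \<gamma> n z) \<le> (K * (\<bar>B\<bar> + 1)) * L2_norm (strip \<gamma>) u" for N
    proof -
      have "cmod (\<Sum>n\<in>{- int N..int N}. ?c n * psi \<gamma> n z) \<le> (\<Sum>n\<in>{- int N..int N}. cmod (?c n * psi \<gamma> n z))"
        by (rule norm_sum)
      also have "\<dots> \<le> (\<Sum>n\<in>{- int N..int N}. L2_norm (strip \<gamma>) u * (K * exp (- (Im z + pi / \<gamma> * of_int n)\<^sup>2)))"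
        unfolding norm_mult norm_psi[OF \<gamma>] K_def[symmetric]
        using K c by (intro sum_mono) (auto intro!: mult_right_mono)
      also have "\<dots> = L2_norm (strip \<gamma>) u * (K * (\<Sum>n\<in>{- int N..int N}. exp (- (Im z + pi / \<gamma> * of_int n)\<^sup>2)))"
        by (simp add: sum_distrib_left)
      also have "\<dots> \<le> L2_norm (strip \<gamma>) u * (K * (\<bar>B\<bar> + 1))"
        using K B[of "{- int N..int N}" "Im z"] by (intro mult_left_mono) auto
      finally show ?thesis by (simp add: mult_ac)
    qed
    then show ?thesis
      by (intro LIMSEQ_le_const2[OF tendsto_norm[OF psi_expansion[OF \<gamma> u]]] exI[of _ 0] allI impI)
  qed
  show ?thesis
  proof (rule that)
    show "0 < K * (\<bar>B\<bar> + 1)" using K by simp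
  qed (use le in blast)
qed

text \<open>The remainder after a partial sum is the pointwise limit of the finite blocks that
  follow it, and orthonormality computes the norms of these blocks exactly. Fatou transfers the
  bound, with no need to identify a limit in norm with \<open>u\<close>.\<close>

lemma psi_dense:
  assumes \<gamma>: "\<gamma> > 0" and u: "u \<in> L2_on (strip \<gamma>)" "u \<in> fock_periodic \<gamma>" and \<epsilon>: "\<epsilon> > 0"
  shows "\<exists>F c. finite F \<and> L2_norm (strip \<gamma>) (\<lambda>z. u z - (\<Sum>n\<in>F. c n * psi \<gamma> n z)) < \<epsilon>"
proof -
  define c where "c n = L2_inner (strip \<gamma>) u (psi \<gamma> n)" for n
  define J where "J N = {- int N..int N}" for N
  define s where "s N = (\<Sum>n\<in>J N. (cmod (c n))\<^sup>2)" for N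
  note orth = psi_orthonormal[OF \<gamma>]
  have J: "finite (J N)" for N by (simp add: J_def)
  have J_mono: "J N \<subseteq> J M" if "N \<le> M" for N M using that by (auto simp: J_def)
  have "incseq s"
    unfolding s_def by (intro incseq_SucI sum_mono2 J J_mono) auto
  moreover have "s N \<le> (L2_norm (strip \<gamma>) u)\<^sup>2" for N
    unfolding s_def c_def by (rule L2_bessel[OF orth J u(1)])
  ultimately obtain L where "s \<longlonglongrightarrow> L"
    using incseq_convergent[of s] by blast
  then have "Cauchy s" by (rule LIMSEQ_imp_Cauchy)
  \<comment> \<open>The squared norm of every block beyond \<open>N\<close> is below this value.
    Half of \<open>\<epsilon>\<close> is used because Fatou preserves only the weak
    inequality.\<close>
  then obtain N where N: "\<And>M. M \<ge> N \<Longrightarrow> \<bar>s M - s N\<bar> < (\<epsilon> / 2)\<^sup>2"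
    using \<epsilon> unfolding Cauchy_iff by (metis order_refl real_norm_def zero_less_power half_gt_zero)
  let ?f = "\<lambda>M z. \<Sum>n\<in>J M - J N. c n * psi \<gamma> n z"
  have diff: "(\<Sum>n\<in>J M - J N. h n) = (\<Sum>n\<in>J M. h n) - (\<Sum>n\<in>J N. h n)"
    if "M \<ge> N" for M and h :: "int \<Rightarrow> 'a::ab_group_add"
    using that by (intro sum_diff J J_mono)
  have "(\<lambda>M. ?f M z) \<longlonglongrightarrow> u z - (\<Sum>n\<in>J N. c n * psi \<gamma> n z)" for z
  proof (rule Lim_transform_eventually)
    show "(\<lambda>M. (\<Sum>n\<in>J M. c n * psi \<gamma> n z) - (\<Sum>n\<in>J N. c n * psi \<gamma> n z))
        \<longlonglongrightarrow> u z - (\<Sum>n\<in>J N. c n * psi \<gamma> n z)"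
      using psi_expansion[OF \<gamma> u, of z] unfolding J_def c_def by (intro tendsto_intros)
    show "\<forall>\<^sub>F M in sequentially. (\<Sum>n\<in>J M. c n * psi \<gamma> n z) - (\<Sum>n\<in>J N. c n * psi \<gamma> n z) = ?f M z"
      using eventually_ge_at_top[of N] by eventually_elim (simp add: diff)
  qed
  moreover have "\<forall>\<^sub>F M in sequentially. L2_norm (strip \<gamma>) (?f M) \<le> \<epsilon> / 2"
    using eventually_ge_at_top[of N]
  proof eventually_elim
    case (elim M)
    have "(L2_norm (strip \<gamma>) (?f M))\<^sup>2 = s M - s N"
      unfolding s_def diff[OF elim, symmetric] by (rule L2_norm_sum_orthonormal[OF orth finite_Diff[OF J]])
    also have "\<dots> \<le> (\<epsilon> / 2)\<^sup>2" using N[OF elim] by linarith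
    finally show ?case by (rule power2_le_imp_le) (use \<epsilon> in simp)
  qed
  ultimately have "L2_norm (strip \<gamma>) (\<lambda>z. u z - (\<Sum>n\<in>J N. c n * psi \<gamma> n z)) \<le> \<epsilon> / 2"
    by (intro L2_fatou(2)[of ?f]) (auto intro!: L2_on_sum psi_in_L2 \<gamma>)
  then show ?thesis using J \<epsilon> by (intro exI[of _ "J N"] exI[of _ c]) auto
qed

text \<open>Removing the Gaussian weight destroys uniformity on the plane, but not on balls, and
  locally uniform convergence is enough for a holomorphic limit. The bound on \<open>v\<close> makes
  it temperate with exponent 0.\<close>

lemma fock_periodic_uniform_limit:
  assumes u: "\<And>k. u k \<in> fock_periodic \<gamma>" and lim: "uniform_limit UNIV u v sequentially"
    and bound: "\<And>z. cmod (v z) \<le> B"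
  shows "v \<in> fock_periodic \<gamma>"
proof -
  define f where "f w z = exp (of_real ((cmod z)\<^sup>2) / 2) * w z" for w :: "complex \<Rightarrow> complex" and z
  have f_eq: "w z = exp (- of_real ((cmod z)\<^sup>2) / 2) * f w z" for w z
    by (simp add: f_def exp_minus)
  have f_hol: "f (u k) holomorphic_on UNIV" for k
  proof -
    obtain g where g: "g holomorphic_on UNIV" "\<And>z. u k z = exp (- of_real ((cmod z)\<^sup>2) / 2) * g z"
      using u[of k] unfolding fock_periodic_def fock_temperate_def by blast
    then have "f (u k) = g" by (auto simp: f_def exp_minus)
    then show ?thesis using g by simp
  qed
  have pt: "(\<lambda>k. u k z) \<longlonglongrightarrow> v z" for z
    using lim by (rule tendsto_uniform_limitI) simp
  have "f v holomorphic_on UNIV"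
  proof (rule holomorphic_uniform_sequence[OF open_UNIV f_hol])
    fix x :: complex
    \<comment> \<open>An upper bound for the inverse Gaussian weight on the unit ball about
      \<open>x\<close>.\<close>
    define R where "R = exp ((cmod x + 1)\<^sup>2 / 2)"
    have R: "R > 0" by (simp add: R_def)
    have "uniform_limit (cball x 1) (\<lambda>k. f (u k)) (f v) sequentially"
    proof (rule uniform_limitI)
      fix e :: real assume "e > 0"
      then have "\<forall>\<^sub>F k in sequentially. \<forall>z\<in>UNIV. dist (u k z) (v z) < e / R"
        using lim R by (intro uniform_limitD) auto
      then show "\<forall>\<^sub>F k in sequentially. \<forall>z\<in>cball x 1. dist (f (u k) z) (f v z) < e"
      proof eventually_elim
        case (elim k)
        show ?case
        proof
          fix z assume "z \<in> cball x 1"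
          then have "cmod z \<le> cmod x + 1"
            using norm_triangle_ineq2[of z x] by (simp add: dist_norm norm_minus_commute)
          then have "exp ((cmod z)\<^sup>2 / 2) \<le> R"
            by (simp add: R_def power_mono)
          moreover have "dist (f (u k) z) (f v z) = exp ((cmod z)\<^sup>2 / 2) * dist (u k z) (v z)"
            by (simp add: f_def dist_norm norm_mult flip: right_diff_distrib)
          ultimately have "dist (f (u k) z) (f v z) \<le> R * dist (u k z) (v z)"
            by (simp add: mult_right_mono)
          also have "\<dots> < e" using elim R by (simp add: field_simps)
          finally show "dist (f (u k) z) (f v z) < e" .
        qed
      qed
    qed
    then show "\<exists>d>0. cball x d \<subseteq> UNIV \<and> uniform_limit (cball x d) (\<lambda>k. f (u k)) (f v) sequentially"
      by (intro exI[of _ 1]) auto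
  qed
  then have "v \<in> fock_temperate"
    by (rule fock_temperate_boundedI[OF _ f_eq bound])
  moreover have "magnetic_translation (of_real \<gamma>) v = v"
  proof
    fix z
    have "(\<lambda>k. magnetic_translation (of_real \<gamma>) (u k) z) \<longlonglongrightarrow> magnetic_translation (of_real \<gamma>) v z"
      unfolding magnetic_translation_def by (intro tendsto_intros pt)
    moreover have "magnetic_translation (of_real \<gamma>) (u k) z = u k z" for k
      using u[of k] by (simp add: fock_periodic_def)
    ultimately show "magnetic_translation (of_real \<gamma>) v z = v z"
      using LIMSEQ_unique[OF _ pt[of z]] by simp
  qed
  ultimately show ?thesis by (simp add: fock_periodic_def)
qed

lemma fock_periodic_complete:
  assumes \<gamma>: "\<gamma> > 0" and u: "\<And>k. u k \<in> L2_on (strip \<gamma>) \<inter> fock_periodic \<gamma>"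
    and cauchy: "\<forall>\<epsilon>>0. \<exists>N. \<forall>j\<ge>N. \<forall>k\<ge>N. L2_norm (strip \<gamma>) (\<lambda>z. u j z - u k z) < \<epsilon>"
  shows "\<exists>v\<in>L2_on (strip \<gamma>) \<inter> fock_periodic \<gamma>.
    (\<lambda>k. L2_norm (strip \<gamma>) (\<lambda>z. u k z - v z)) \<longlonglongrightarrow> 0"
proof -
  obtain C where C: "C > 0"
    "\<And>u z. u \<in> L2_on (strip \<gamma>) \<inter> fock_periodic \<gamma> \<Longrightarrow> cmod (u z) \<le> C * L2_norm (strip \<gamma>) u"
    using fock_periodic_pointwise_bound[OF \<gamma>] by blast
  have "uniformly_Cauchy_on UNIV u"
    unfolding uniformly_Cauchy_on_def
  proof (intro allI impI)
    fix e :: real assume "e > 0"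
    then obtain N where N: "\<And>j k. j \<ge> N \<Longrightarrow> k \<ge> N \<Longrightarrow> L2_norm (strip \<gamma>) (\<lambda>z. u j z - u k z) < e / C"
      using cauchy C(1) by (meson divide_pos_pos)
    have "dist (u j z) (u k z) < e" if "j \<ge> N" "k \<ge> N" for j k z
    proof -
      have "(\<lambda>z. u j z - u k z) \<in> L2_on (strip \<gamma>) \<inter> fock_periodic \<gamma>"
        using u by (auto intro!: L2_on_diff fock_periodic_diff)
      then have "dist (u j z) (u k z) \<le> C * L2_norm (strip \<gamma>) (\<lambda>z. u j z - u k z)"
        unfolding dist_norm by (rule C(2))
      also have "\<dots> < e" using N[OF that] C(1) by (simp add: field_simps)
      finally show ?thesis .
    qed
    then show "\<exists>M. \<forall>x\<in>UNIV. \<forall>m\<ge>M. \<forall>n\<ge>M. dist (u m x) (u n x) < e" by blast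
  qed
  then obtain v where lim: "uniform_limit UNIV u v sequentially"
    using uniformly_convergent_eq_Cauchy uniformly_convergent_on_def by metis
  have pt: "(\<lambda>k. u k z) \<longlonglongrightarrow> v z" for z
    using lim by (rule tendsto_uniform_limitI) simp
  \<comment> \<open>Fatou in the index \<open>j\<close>, with \<open>k\<close> fixed: the Cauchy
    condition turns into closeness to the limit.\<close>
  have close: "(\<lambda>z. u k z - v z) \<in> L2_on (strip \<gamma>)" "L2_norm (strip \<gamma>) (\<lambda>z. u k z - v z) \<le> e"
    if N: "\<And>j. j \<ge> N \<Longrightarrow> L2_norm (strip \<gamma>) (\<lambda>z. u k z - u j z) < e" for k e N
  proof -
    have "(\<lambda>z. u k z - u j z) \<in> L2_on (strip \<gamma>)" for j
      using u by (auto intro!: L2_on_diff)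
    moreover have "(\<lambda>j. u k z - u j z) \<longlonglongrightarrow> u k z - v z" for z
      by (intro tendsto_intros pt)
    moreover have "\<forall>\<^sub>F j in sequentially. L2_norm (strip \<gamma>) (\<lambda>z. u k z - u j z) \<le> e"
      using eventually_ge_at_top[of N] by eventually_elim (use N in \<open>auto intro: less_imp_le\<close>)
    ultimately show "(\<lambda>z. u k z - v z) \<in> L2_on (strip \<gamma>)" "L2_norm (strip \<gamma>) (\<lambda>z. u k z - v z) \<le> e"
      using L2_fatou[of "\<lambda>j z. u k z - u j z" "strip \<gamma>" "\<lambda>z. u k z - v z" e] by auto
  qed
  obtain N where "\<And>j k. j \<ge> N \<Longrightarrow> k \<ge> N \<Longrightarrow> L2_norm (strip \<gamma>) (\<lambda>z. u j z - u k z) < 1"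
    using cauchy by (meson zero_less_one)
  then have "(\<lambda>z. u N z - v z) \<in> L2_on (strip \<gamma>)"
    by (intro close(1)[of N N 1]) auto
  \<comment> \<open>\<open>v\<close> is recovered as \<open>u N\<close> minus the difference just
    shown to lie in L^2.\<close>
  from L2_on_diff[OF _ this, of "u N"] have v_L2: "v \<in> L2_on (strip \<gamma>)"
    using u by simp
  \<comment> \<open>One member within distance 1 of \<open>v\<close> everywhere suffices: that
    member is bounded by its norm, hence \<open>v\<close> is bounded.\<close>
  have "\<forall>\<^sub>F k in sequentially. \<forall>z\<in>UNIV. dist (u k z) (v z) < 1"
    using lim by (intro uniform_limitD) auto
  then obtain k where k: "\<And>z. dist (u k z) (v z) < 1"
    by (auto simp: eventually_sequentially)
  have "v \<in> fock_periodic \<gamma>"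
  proof (rule fock_periodic_uniform_limit[OF _ lim])
    show "cmod (v z) \<le> C * L2_norm (strip \<gamma>) (u k) + 1" for z
      using C(2)[OF u, of k z] k[of z] norm_triangle_sub[of "v z" "u k z"]
      by (simp add: dist_norm norm_minus_commute)
  qed (use u in auto)
  moreover have "(\<lambda>k. L2_norm (strip \<gamma>) (\<lambda>z. u k z - v z)) \<longlonglongrightarrow> 0"
  proof (rule LIMSEQ_I)
    fix r :: real assume "r > 0"
    then obtain N where N: "\<And>j k. j \<ge> N \<Longrightarrow> k \<ge> N \<Longrightarrow> L2_norm (strip \<gamma>) (\<lambda>z. u j z - u k z) < r / 2"
      using cauchy by (meson half_gt_zero)
    have "L2_norm (strip \<gamma>) (\<lambda>z. u k z - v z) \<le> r / 2" if "k \<ge> N" for k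
      by (rule close(2)[of N]) (use N that in auto)
    then show "\<exists>N. \<forall>k\<ge>N. norm (L2_norm (strip \<gamma>) (\<lambda>z. u k z - v z) - 0) < r"
      using \<open>r > 0\<close> by (intro exI[of _ N]) force
  qed
  ultimately show ?thesis using v_L2 by auto
qed

theorem lemma3p4:
  fixes \<gamma> :: real
  assumes "\<gamma> > 0"
  shows "L2_orthonormal (strip \<gamma>) (psi \<gamma>) \<and>
         L2_hilbert_basis (strip \<gamma>) (L2_on (strip \<gamma>) \<inter> fock_periodic \<gamma>) (psi \<gamma>)"
proof -
  let ?S = "strip \<gamma>" and ?V = "L2_on (strip \<gamma>) \<inter> fock_periodic \<gamma>"
  have psi_V: "psi \<gamma> n \<in> ?V" for n
    using psi_in_L2 psi_in_fock_periodic assms by blast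
  have "u = (\<lambda>z. 0)" if "u \<in> ?V" "L2_norm ?S u = 0" for u
    using fock_periodic_pointwise_bound[OF assms] that by (metis mult_zero_right norm_le_zero_iff)
  moreover have "(\<lambda>z. 0) \<in> ?V"
    using fock_periodic_scale[of "psi \<gamma> 0" \<gamma> 0] psi_V[of 0] by auto
  ultimately have "L2_hilbert_space ?S ?V"
    unfolding L2_hilbert_space_def using fock_periodic_complete[OF assms]
    by (auto intro: L2_on_add L2_on_scale fock_periodic_add fock_periodic_scale)
  then show ?thesis
    unfolding L2_hilbert_basis_def
    using psi_orthonormal[OF assms] psi_V psi_dense[OF assms] by blast
qed

end
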